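(* Let $T$ be a tree of order $n \ge 4$. If $\gamma_{nt}(T) = n/2$, then $T \in \mathcal{T}$.
   Context: All graphs are finite and simple. For a vertex $v$ of a graph $G$, $N(v)$ denotes its open neighborhood (the set of neighbors of $v$); for $S \subseteq V(G)$, $N(S) = \bigcup_{v \in S} N(v)$ and $N[S] = N(S) \cup S$. A neighborhood total dominating set (NTD-set) of $G$ is a set $S \subseteq V(G)$ that is a dominating set of $G$ (i.e. $N[S] = V(G)$) such that the subgraph of $G$ induced by $N(S)$ has no isolated vertex. The neighborhood total domination number $\gamma_{nt}(G)$ is the minimum cardinality of an NTD-set of $G$. A $2$-packing in a graph is a set of vertices pairwise at distance at least $3$. The family $\mathcal{T}$ of trees is defined as follows. Let $T_0$ be an arbitrary tree. Let $T_1$ be the tree obtained from $T_0$ by doing, for each vertex $x \in V(T_0)$, exactly one of the following: either add one new vertex and an edge joining it to $x$, or add a new path $P_3$ (on three new vertices) and an edge joining the central vertex of this $P_3$ to $x$. Then $\mathcal{T}$ is the family of all trees $T$ that can be obtained from such a $T_1$ by the following operation: choose a set $L_1$ of leaves of $T_1$ that forms a $2$-packing in $T_1$ (possibly $L_1 = \emptyset$), and for each vertex $v \in L_1$ add some number $k \ge 0$ of vertex-disjoint new copies of $P_2$ and join $v$ by an edge to exactly one end of each added copy of $P_2$. *)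

theory Defs
  imports Main
begin

text \<open>Finite simple graphs: a vertex set V and a set E of 2-element subsets of V.\<close>

definition simple_graph :: "'a set \<Rightarrow> 'a set set \<Rightarrow> bool" where
  "simple_graph V E \<longleftrightarrow> finite V \<and>
     (\<forall>e\<in>E. \<exists>u v. e = {u, v} \<and> u \<noteq> v \<and> u \<in> V \<and> v \<in> V)"

definition adj_rel :: "'a set set \<Rightarrow> ('a \<times> 'a) set" where
  "adj_rel E = {(u, v). {u, v} \<in> E \<and> u \<noteq> v}"

definition nbhd :: "'a set set \<Rightarrow> 'a \<Rightarrow> 'a set" where
  "nbhd E v = {u. {u, v} \<in> E \<and> u \<noteq> v}"

definition nbhd_set :: "'a set set \<Rightarrow> 'a set \<Rightarrow> 'a set" where
  "nbhd_set E S = (\<Union>v\<in>S. nbhd E v)"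

definition connected_graph :: "'a set \<Rightarrow> 'a set set \<Rightarrow> bool" where
  "connected_graph V E \<longleftrightarrow> (\<forall>u\<in>V. \<forall>v\<in>V. (u, v) \<in> (adj_rel E)\<^sup>*)"

text \<open>A cycle: at least 3 distinct vertices, consecutive ones adjacent, last adjacent to first.\<close>
definition is_cycle :: "'a set set \<Rightarrow> 'a list \<Rightarrow> bool" where
  "is_cycle E xs \<longleftrightarrow> distinct xs \<and> length xs \<ge> 3 \<and>
     (\<forall>i. Suc i < length xs \<longrightarrow> {xs ! i, xs ! Suc i} \<in> E) \<and>
     {last xs, hd xs} \<in> E"

definition is_tree :: "'a set \<Rightarrow> 'a set set \<Rightarrow> bool" where
  "is_tree V E \<longleftrightarrow> simple_graph V E \<and> V \<noteq> {} \<and> connected_graph V E \<and>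
     \<not> (\<exists>xs. is_cycle E xs)"

definition dominating :: "'a set \<Rightarrow> 'a set set \<Rightarrow> 'a set \<Rightarrow> bool" where
  "dominating V E S \<longleftrightarrow> S \<subseteq> V \<and> nbhd_set E S \<union> S = V"

text \<open>Neighborhood total dominating set: dominating, and the subgraph induced by N(S)
  has no isolated vertex.\<close>
definition ntd_set :: "'a set \<Rightarrow> 'a set set \<Rightarrow> 'a set \<Rightarrow> bool" where
  "ntd_set V E S \<longleftrightarrow> dominating V E S \<and>
     (\<forall>u\<in>nbhd_set E S. \<exists>w\<in>nbhd_set E S. {u, w} \<in> E \<and> u \<noteq> w)"

definition gamma_nt :: "'a set \<Rightarrow> 'a set set \<Rightarrow> nat" where
  "gamma_nt V E = (LEAST k. \<exists>S. ntd_set V E S \<and> card S = k)"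

definition is_leaf :: "'a set set \<Rightarrow> 'a \<Rightarrow> bool" where
  "is_leaf E v \<longleftrightarrow> card (nbhd E v) = 1"

text \<open>2-packing: pairwise distance at least 3, i.e. distinct vertices are not joined by
  any walk of length at most 2.\<close>
definition two_packing :: "'a set set \<Rightarrow> 'a set \<Rightarrow> bool" where
  "two_packing E L \<longleftrightarrow>
     (\<forall>u\<in>L. \<forall>v\<in>L. u \<noteq> v \<longrightarrow> (\<forall>k\<le>2. (u, v) \<notin> (adj_rel E) ^^ k))"

text \<open>Step 1: T1 from T0. For each x in V0 the new vertices are g(x,i): if x \<in> A a single
  pendant vertex g(x,0); otherwise a P3  g(x,0) - g(x,1) - g(x,2) whose centre g(x,1) is
  joined to x. All new vertices are distinct and not in V0.\<close>
definition step1_dom :: "'a set \<Rightarrow> 'a set \<Rightarrow> ('a \<times> nat) set" where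
  "step1_dom V0 A = {(x, i). x \<in> V0 \<and> (if x \<in> A then i = 0 else i < 3)}"

definition step1 :: "'a set \<Rightarrow> 'a set set \<Rightarrow> 'a set \<Rightarrow> 'a set set \<Rightarrow> bool" where
  "step1 V0 E0 V1 E1 \<longleftrightarrow> (\<exists>A g. A \<subseteq> V0 \<and>
     inj_on g (step1_dom V0 A) \<and> g ` step1_dom V0 A \<inter> V0 = {} \<and>
     V1 = V0 \<union> g ` step1_dom V0 A \<and>
     E1 = E0 \<union> {{x, g (x, 0)} | x. x \<in> A}
             \<union> {{x, g (x, 1)} | x. x \<in> V0 - A}
             \<union> {{g (x, 0), g (x, 1)} | x. x \<in> V0 - A}
             \<union> {{g (x, 1), g (x, 2)} | x. x \<in> V0 - A})"

text \<open>Step 2: T from T1. L1 is a 2-packing of leaves of T1; to each v \<in> L1 we attach k v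
  copies of P2  h(v,j,0) - h(v,j,1), with v joined to h(v,j,0).\<close>
definition step2_dom :: "'a set \<Rightarrow> ('a \<Rightarrow> nat) \<Rightarrow> ('a \<times> nat \<times> nat) set" where
  "step2_dom L1 k = {(v, j, i). v \<in> L1 \<and> j < k v \<and> i < 2}"

definition step2 :: "'a set \<Rightarrow> 'a set set \<Rightarrow> 'a set \<Rightarrow> 'a set set \<Rightarrow> bool" where
  "step2 V1 E1 V E \<longleftrightarrow> (\<exists>L1 k h. L1 \<subseteq> V1 \<and> (\<forall>v\<in>L1. is_leaf E1 v) \<and> two_packing E1 L1 \<and>
     inj_on h (step2_dom L1 k) \<and> h ` step2_dom L1 k \<inter> V1 = {} \<and>
     V = V1 \<union> h ` step2_dom L1 k \<and>
     E = E1 \<union> {{v, h (v, j, 0)} | v j. v \<in> L1 \<and> j < k v}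
            \<union> {{h (v, j, 0), h (v, j, 1)} | v j. v \<in> L1 \<and> j < k v})"

text \<open>The family \<T>: trees obtainable by the construction (identified with T's own vertex labels).\<close>
definition in_family_T :: "'a set \<Rightarrow> 'a set set \<Rightarrow> bool" where
  "in_family_T V E \<longleftrightarrow> (\<exists>V0 E0 V1 E1. is_tree V0 E0 \<and> step1 V0 E0 V1 E1 \<and> step2 V1 E1 V E)"

end

theory Submission
  imports Defs
begin

text \<open>
  An even tree splits into connected blocks whose inner degrees are all odd: cut along edges
  with even sides as long as there are any. Such a block is a \<open>K\<^sub>2\<close>, a claw \<open>K\<^sub>1\<^sub>,\<^sub>3\<close>, or has
  an NTD-set of size at most half its order minus one (its internal vertices, by counting degrees).
  An NTD-set of a union of blocks extends to the neighbouring blocks at the cost of half of their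
  vertices, even through a \<open>K\<^sub>2\<close>, whose own NTD-sets are too large. Hence, if \<open>2 \<gamma>\<^sub>n\<^sub>t = n\<close>, no union of
  blocks has an NTD-set smaller than half its order. This excludes the third kind of block and
  restricts how blocks are attached to each other: in a \<open>K\<^sub>2\<close> at most one end, and in a claw at most
  one leaf, carries a branch other than a pendant \<open>P\<^sub>2\<close>; the centre of a claw carries no branch, and
  neither does one of its leaves. Taking from each block the vertex that carries the arbitrary
  branches gives \<open>T\<^sub>0\<close>, and the pendant \<open>P\<^sub>2\<close>s at the other vertices are those of the second step.
\<close>

section \<open>Connected subsets of a tree\<close>

text \<open>All counts concern the excess \<open>2 * card S - card U\<close> of an NTD-set
  \<open>S\<close> of a union \<open>U\<close> of blocks. Extension to further blocks never
  increases it and extremality forbids a negative value on \<open>V\<close>, hence on every union.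
  Each forbidden configuration has excess at most -2: one vertex pays for a whole claw, or none for
  a \<open>K\<^sub>2\<close>, while the branches pay for themselves. The obstacle is the isolated
  \<open>K\<^sub>2\<close>: the neighbourhood of one of its vertices is a single isolated vertex, so
  it needs both. Beside a set already treated, one vertex is enough, since that set supplies a
  second dominator or a partner in the neighbourhood. Among connected unions of
  \<open>K\<^sub>2\<close>s and claws only a lone \<open>K\<^sub>2\<close> has no NTD-set of half
  its order through a prescribed vertex. Therefore pendant \<open>P\<^sub>2\<close>s, and no other
  branches, escape most exclusions, and the second step of the construction has to provide for
  them.\<close>

lemma rtrancl_distinct_path:
  assumes "(x, y) \<in> r\<^sup>*"
  shows "\<exists>xs. xs \<noteq> [] \<and> distinct xs \<and> hd xs = x \<and> last xs = y \<and> successively (\<lambda>a b. (a, b) \<in> r) xs"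
  using assms
proof (induction rule: converse_rtrancl_induct)
  case base
  then show ?case by (intro exI[of _ "[y]"]) auto
next
  case (step a b)
  then obtain xs where xs: "xs \<noteq> []" "distinct xs" "hd xs = b" "last xs = y"
    "successively (\<lambda>a b. (a, b) \<in> r) xs" by blast
  show ?case
  \<comment> \<open>If the path already visits \<open>a\<close>, the loop is cut off by starting at
    that visit.\<close>
  proof (cases "a \<in> set xs")
    case True
    then obtain us vs where "xs = us @ a # vs" by (meson split_list)
    with xs show ?thesis
      by (intro exI[of _ "a # vs"]) (auto simp: successively_append_iff)
  next
    case False
    with xs step(1) show ?thesis
      by (intro exI[of _ "a # xs"]) (auto simp: successively_Cons)
  qed
qed

text \<open>A path from \<open>x\<close> to \<open>y\<close> that avoids the edge would close up
  with it to a cycle. In this form acyclicity can be used without lists.\<close>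

lemma acyclic_edge_is_bridge:
  assumes nocyc: "\<not> (\<exists>xs. is_cycle E xs)" and xy: "{x, y} \<in> E" "x \<noteq> y"
  shows "(x, y) \<notin> {(a, b). ({a, b} \<in> E \<and> a \<noteq> b) \<and> {a, b} \<noteq> {x, y}}\<^sup>*" (is "_ \<notin> ?r\<^sup>*")
proof
  assume "(x, y) \<in> ?r\<^sup>*"
  then obtain xs where xs: "xs \<noteq> []" "distinct xs" "hd xs = x" "last xs = y"
    "successively (\<lambda>a b. (a, b) \<in> ?r) xs" using rtrancl_distinct_path[of x y ?r] by blast
  \<comment> \<open>A path with two vertices would be the excluded edge itself.\<close>
  have "length xs \<ge> 3"
  proof (rule ccontr)
    assume "\<not> ?thesis"
    moreover have "length xs \<noteq> 0" using xs(1) by simp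
    ultimately have "length xs = 1 \<or> length xs = 2" by linarith
    then consider a where "xs = [a]" | a b where "xs = [a, b]"
      by (auto simp: length_Suc_conv numeral_2_eq_2)
    then show False using xs xy by cases auto
  qed
  moreover have "\<forall>i. Suc i < length xs \<longrightarrow> {xs ! i, xs ! Suc i} \<in> E"
    using xs(5) by (auto simp: successively_conv_nth)
  ultimately have "is_cycle E xs"
    using xs xy by (auto simp: is_cycle_def insert_commute)
  with nocyc show False by blast
qed

locale tree_adj =
  fixes V :: "'a set" and adj :: "'a \<Rightarrow> 'a \<Rightarrow> bool"
  assumes finV: "finite V"
    and adj_sym: "adj u v \<Longrightarrow> adj v u"
    and adj_irrefl: "\<not> adj u u"
    and adjV: "adj u v \<Longrightarrow> u \<in> V"
    and bridge: "adj x y \<Longrightarrow> (x, y) \<notin> {(a, b). adj a b \<and> {a, b} \<noteq> {x, y}}\<^sup>*"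
begin

definition rel :: "'a set \<Rightarrow> ('a \<times> 'a) set" where
  "rel U = {(a, b). a \<in> U \<and> b \<in> U \<and> adj a b}"

text \<open>For \<open>a \<in> U\<close> this is the component of \<open>a\<close> in the subgraph
  induced by \<open>U\<close>.\<close>

definition reach :: "'a set \<Rightarrow> 'a \<Rightarrow> 'a set" where
  "reach U a = {v. (a, v) \<in> (rel U)\<^sup>*}"

definition conn :: "'a set \<Rightarrow> bool" where
  "conn U \<longleftrightarrow> (\<forall>u\<in>U. \<forall>v\<in>U. (u, v) \<in> (rel U)\<^sup>*)"

definition nb :: "'a set \<Rightarrow> 'a \<Rightarrow> 'a set" where
  "nb U x = {y \<in> U. adj x y}"

lemma rel_sym: "(a, b) \<in> (rel U)\<^sup>* \<Longrightarrow> (b, a) \<in> (rel U)\<^sup>*"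
proof -
  have "sym (rel U)" using adj_sym by (auto simp: rel_def sym_def)
  then show "(a, b) \<in> (rel U)\<^sup>* \<Longrightarrow> (b, a) \<in> (rel U)\<^sup>*"
    using sym_rtrancl symD by metis
qed

lemma rel_mono: "U \<subseteq> W \<Longrightarrow> (rel U)\<^sup>* \<subseteq> (rel W)\<^sup>*"
  by (rule rtrancl_mono) (auto simp: rel_def)

lemma reach_self: "a \<in> reach U a" by (simp add: reach_def)

lemma reach_subset: "a \<in> U \<Longrightarrow> reach U a \<subseteq> U"
proof
  fix v assume "a \<in> U" "v \<in> reach U a"
  then have "(a, v) \<in> (rel U)\<^sup>*" by (simp add: reach_def)
  then show "v \<in> U" using \<open>a \<in> U\<close> by (induction) (auto simp: rel_def)
qed

lemma reach_closed: "u \<in> reach U a \<Longrightarrow> u \<in> U \<Longrightarrow> v \<in> U \<Longrightarrow> adj u v \<Longrightarrow> v \<in> reach U a"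
  unfolding reach_def rel_def by (auto intro: rtrancl_into_rtrancl)

lemma conn_reach:
  assumes "a \<in> U" shows "conn (reach U a)"
proof -
  have *: "(a, v) \<in> (rel (reach U a))\<^sup>*" if "v \<in> reach U a" for v
  proof -
    from that have "(a, v) \<in> (rel U)\<^sup>*" by (simp add: reach_def)
    then show ?thesis
    proof induction
      case (step y z)
      then have "y \<in> reach U a" "z \<in> reach U a"
        by (auto simp: reach_def intro: rtrancl_into_rtrancl)
      with step show ?case by (auto simp: rel_def intro: rtrancl_into_rtrancl)
    qed simp
  qed
  show ?thesis unfolding conn_def using * rel_sym rtrancl_trans by metis
qed

lemma conn_exit:
  assumes "conn B" "X \<subseteq> B" "X \<noteq> {}" "X \<noteq> B"
  shows "\<exists>u\<in>X. \<exists>v\<in>B - X. adj u v"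
proof (rule ccontr)
  assume no: "\<not> ?thesis"
  obtain x z where xz: "x \<in> X" "z \<in> B" "z \<notin> X" using assms by blast
  then have "(x, z) \<in> (rel B)\<^sup>*" using assms by (auto simp: conn_def)
  then have "z \<in> X" using no xz(1) by induction (auto simp: rel_def)
  with xz show False by simp
qed

lemma conn_subset_reach:
  assumes "conn C" "C \<subseteq> U" "v \<in> C" "v \<in> reach U a"
  shows "C \<subseteq> reach U a"
proof
  fix z assume "z \<in> C"
  then have "(v, z) \<in> (rel U)\<^sup>*" using assms rel_mono[of C U] by (auto simp: conn_def)
  then show "z \<in> reach U a" using assms(4) by (auto simp: reach_def)
qed

text \<open>Otherwise there is a detour around the edge from \<open>y1\<close> to \<open>w1\<close>:
  inside \<open>B\<close> to \<open>y2\<close>, over to \<open>w2\<close>, and back to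
  \<open>w1\<close> outside \<open>B\<close>. This contradicts \<open>bridge\<close>.\<close>

lemma attachment_unique:
  assumes B: "conn B" "y1 \<in> B" "y2 \<in> B" and w: "w1 \<notin> B" "w2 \<notin> B"
    and adj: "adj y1 w1" "adj y2 w2" and r: "(w1, w2) \<in> (rel (- B))\<^sup>*"
  shows "y1 = y2 \<and> w1 = w2"
proof (rule ccontr)
  assume ne: "\<not> ?thesis"
  let ?r = "{(a, b). adj a b \<and> {a, b} \<noteq> {y1, w1}}"
  have "(y1, y2) \<in> (rel B)\<^sup>*" using B by (auto simp: conn_def)
  moreover have "rel B \<subseteq> ?r" using w by (auto simp: rel_def doubleton_eq_iff)
  ultimately have 1: "(y1, y2) \<in> ?r\<^sup>*" using rtrancl_mono by blast
  have 2: "(y2, w2) \<in> ?r" using adj ne B w by (auto simp: doubleton_eq_iff)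
  have "(w2, w1) \<in> (rel (- B))\<^sup>*" using r rel_sym by blast
  moreover have "rel (- B) \<subseteq> ?r" using B by (auto simp: rel_def doubleton_eq_iff)
  ultimately have 3: "(w2, w1) \<in> ?r\<^sup>*" using rtrancl_mono by blast
  from 1 2 3 have "(y1, w1) \<in> ?r\<^sup>*" by (meson rtrancl.rtrancl_into_rtrancl rtrancl_trans)
  with bridge[OF adj(1)] show False by blast
qed

text \<open>The contrapositive is the main use: different edges leaving a connected set lead into
  disjoint components.\<close>

lemma reach_attachment_unique:
  assumes "conn B" "y1 \<in> B" "y2 \<in> B" "w1 \<in> U - B" "w2 \<in> U - B"
    and "adj y1 w1" "adj y2 w2" and "reach (U - B) w1 \<inter> reach (U - B) w2 \<noteq> {}"
  shows "y1 = y2 \<and> w1 = w2"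
proof -
  obtain z where "(w1, z) \<in> (rel (U - B))\<^sup>*" "(w2, z) \<in> (rel (U - B))\<^sup>*"
    using assms(8) by (auto simp: reach_def)
  then have "(w1, w2) \<in> (rel (U - B))\<^sup>*" using rel_sym rtrancl_trans by metis
  then have "(w1, w2) \<in> (rel (- B))\<^sup>*" using rel_mono[of "U - B" "- B"] by blast
  then show ?thesis using attachment_unique[of B y1 y2 w1 w2] assms by blast
qed

section \<open>Removing a vertex or a branch\<close>

lemma conn_singleton: "conn {x}" by (simp add: conn_def)

text \<open>A walk from \<open>x\<close> can leave the removed branch only through \<open>x\<close>,
  so the part of the walk after its last visit to \<open>x\<close> avoids the branch.\<close>

lemma conn_remove_branch:
  assumes "conn W" "x \<in> W" "y \<in> W" "adj x y"
  shows "conn (W - reach (W - {x}) y)" "x \<in> W - reach (W - {x}) y"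
proof -
  let ?U = "reach (W - {x}) y"
  have "y \<in> W - {x}" using assms adj_irrefl by blast
  then have sub: "?U \<subseteq> W - {x}" by (rule reach_subset)
  then show x: "x \<in> W - ?U" using assms by blast
  have *: "v \<in> ?U \<or> (x, v) \<in> (rel (W - ?U))\<^sup>*" if "(x, v) \<in> (rel W)\<^sup>*" for v
    using that
  proof induction
    case (step u v)
    have uv: "u \<in> W" "v \<in> W" "adj u v" using step by (auto simp: rel_def)
    show ?case
    proof (cases "v \<in> ?U \<or> v = x")
      case False
      then have "u \<notin> ?U" using reach_closed[of u "W - {x}" y v] uv sub by blast
      with step uv False have "(x, u) \<in> (rel (W - ?U))\<^sup>*" "(u, v) \<in> rel (W - ?U)"
        by (auto simp: rel_def)
      then show ?thesis by (meson rtrancl.rtrancl_into_rtrancl)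
    qed auto
  qed simp
  then show "conn (W - ?U)"
    using assms x unfolding conn_def by (metis DiffE rel_sym rtrancl_trans)
qed

lemma branches:
  assumes "conn W" "x \<in> W"
  shows "W - {x} = (\<Union>y\<in>nb W x. reach (W - {x}) y)"
proof
  show "(\<Union>y\<in>nb W x. reach (W - {x}) y) \<subseteq> W - {x}"
    using reach_subset[of _ "W - {x}"] adj_irrefl by (fastforce simp: nb_def)
  let ?X = "insert x (\<Union>y\<in>nb W x. reach (W - {x}) y)"
  have sub: "?X \<subseteq> W" using \<open>(\<Union>y\<in>nb W x. reach (W - {x}) y) \<subseteq> W - {x}\<close> assms by blast
  have "?X = W"
  proof (rule ccontr)
    assume "?X \<noteq> W"
    then obtain u v where uv: "u \<in> ?X" "v \<in> W - ?X" "adj u v"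
      using conn_exit[OF assms(1) sub] by blast
    then show False
    proof (cases "u = x")
      case True
      then have "v \<in> nb W x" using uv by (auto simp: nb_def)
      then show False using uv reach_self by fastforce
    next
      case False
      then show False using uv sub reach_closed[of u "W - {x}" _ v] by blast
    qed
  qed
  then show "W - {x} \<subseteq> (\<Union>y\<in>nb W x. reach (W - {x}) y)" by blast
qed

text \<open>The odd number \<open>card W - 1\<close> is the sum of the branch orders, one branch per
  neighbour of \<open>x\<close>. If every summand is odd, so is the number of summands.\<close>

lemma odd_degrees_if_odd_branches:
  assumes W: "conn W" "finite W" "even (card W)" "x \<in> W"
    and odd: "\<And>y. y \<in> W \<Longrightarrow> adj x y \<Longrightarrow> odd (card (reach (W - {x}) y))"
  shows "odd (card (nb W x))"
proof -
  have sub: "reach (W - {x}) y \<subseteq> W" if "y \<in> nb W x" for y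
    using that reach_subset[of y "W - {x}"] adj_irrefl by (fastforce simp: nb_def)
  have "card (\<Union>y\<in>nb W x. reach (W - {x}) y) = (\<Sum>y\<in>nb W x. card (reach (W - {x}) y))"
  proof (rule card_UN_disjoint)
    show "finite (nb W x)" using W by (auto simp: nb_def)
    show "\<forall>y\<in>nb W x. finite (reach (W - {x}) y)" using sub W finite_subset by blast
    show "\<forall>i\<in>nb W x. \<forall>j\<in>nb W x. i \<noteq> j \<longrightarrow> reach (W - {x}) i \<inter> reach (W - {x}) j = {}"
    proof (intro ballI impI, rule ccontr)
      fix i j assume ij: "i \<in> nb W x" "j \<in> nb W x" "i \<noteq> j"
        "reach (W - {x}) i \<inter> reach (W - {x}) j \<noteq> {}"
      then have "i \<in> W - {x}" "j \<in> W - {x}" "adj x i" "adj x j"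
        using adj_irrefl by (auto simp: nb_def)
      then show False
        using reach_attachment_unique[OF conn_singleton[of x], of x x i W j] ij by auto
    qed
  qed
  then have "card (W - {x}) = (\<Sum>y\<in>nb W x. card (reach (W - {x}) y))"
    by (rule trans[OF arg_cong[OF branches[OF W(1,4)], of card]])
  moreover have "odd (card (W - {x}))" using card.remove[OF W(2,4)] W(3) by presburger
  moreover have "even (\<Sum>y\<in>nb W x. card (reach (W - {x}) y)) \<longleftrightarrow> even (card (nb W x))"
  proof -
    have "{y \<in> nb W x. odd (card (reach (W - {x}) y))} = nb W x"
      using odd by (auto simp: nb_def)
    then show ?thesis using W by (subst even_sum_iff) (auto simp: nb_def)
  qed
  ultimately show ?thesis by simp
qed

section \<open>Partition into odd blocks\<close>

definition odd_block :: "'a set \<Rightarrow> bool" where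
  "odd_block B \<longleftrightarrow> B \<noteq> {} \<and> conn B \<and> (\<forall>x\<in>B. odd (card (nb B x)))"

text \<open>Cutting off an even branch leaves two connected sets of even order, so induction applies
  to both. If no edge can be cut, \<open>odd_degrees_if_odd_branches\<close> makes \<open>W\<close>
  itself a block.\<close>

lemma odd_partition:
  assumes "finite W" "conn W" "even (card W)" "W \<noteq> {}"
  shows "\<exists>P. \<Union>P = W \<and> pairwise disjnt P \<and> (\<forall>B\<in>P. odd_block B)"
  using assms
proof (induction "card W" arbitrary: W rule: less_induct)
  case less
  show ?case
  proof (cases "\<forall>x\<in>W. \<forall>y\<in>W. adj x y \<longrightarrow> odd (card (reach (W - {x}) y))")
    case True
    then have "odd (card (nb W x))" if "x \<in> W" for x
      using that less.prems odd_degrees_if_odd_branches[of W x] by blast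
    then have "odd_block W" using less.prems unfolding odd_block_def by blast
    then show ?thesis by (intro exI[of _ "{W}"]) auto
  next
    case False
    then obtain x y where xy: "x \<in> W" "y \<in> W" "adj x y" and ev: "even (card (reach (W - {x}) y))"
      by blast
    let ?U = "reach (W - {x}) y"
    have y: "y \<in> W - {x}" using xy adj_irrefl by blast
    have U: "?U \<subseteq> W - {x}" "y \<in> ?U" using reach_subset[OF y] reach_self by auto
    have fin: "finite ?U" using U less.prems finite_subset by blast
    have "?U \<subseteq> W" using U by blast
    then have "card (W - ?U) + card ?U = card W"
      using card_Diff_subset[OF fin, of W] card_mono[OF less(2), of ?U] by linarith
    then have ev': "even (card (W - ?U))" using ev less.prems(3) by (metis even_add)
    have "card ?U < card W" "card (W - ?U) < card W"
      using U less.prems xy by (auto intro!: psubset_card_mono)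
    note lt = this
    obtain P where P: "\<Union>P = ?U" "pairwise disjnt P" "\<forall>B\<in>P. odd_block B"
      using less(1)[OF lt(1) fin conn_reach[OF y] ev] U by blast
    obtain Q where Q: "\<Union>Q = W - ?U" "pairwise disjnt Q" "\<forall>B\<in>Q. odd_block B"
      using less(1)[OF lt(2) _ conn_remove_branch(1)[OF less(3) xy] ev'] less(2)
        conn_remove_branch(2)[OF less(3) xy] by blast
    have "disjnt B C" if "B \<in> P" "C \<in> Q" for B C
      using that P(1) Q(1) by (force simp: disjnt_def)
    then have "pairwise disjnt (P \<union> Q)"
      using P Q by (auto simp: pairwise_def disjnt_sym)
    moreover have "\<Union>(P \<union> Q) = W" using P Q U by auto
    ultimately show ?thesis using P Q by (intro exI[of _ "P \<union> Q"]) auto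
  qed
qed

section \<open>Degree count\<close>

text \<open>Cutting one edge gives two smaller trees, and the edge restores 2 to the degree sum:
  \<open>(2a - 2) + (2b - 2) + 2 = 2(a + b) - 2\<close>.\<close>

lemma degree_sum:
  assumes "finite W" "conn W" "W \<noteq> {}"
  shows "(\<Sum>x\<in>W. card (nb W x)) + 2 = 2 * card W"
  using assms
proof (induction "card W" arbitrary: W rule: less_induct)
  case less
  obtain x where x: "x \<in> W" using less.prems by blast
  show ?case
  proof (cases "W = {x}")
    case True
    then have "nb W x = {}" using adj_irrefl by (auto simp: nb_def)
    then show ?thesis using True by simp
  next
    case False
    then obtain y where xy: "y \<in> W" "adj x y" using conn_exit[of W "{x}"] less.prems x by blast
    let ?U = "reach (W - {x}) y"
    have y: "y \<in> W - {x}" using xy adj_irrefl by blast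
    have U: "?U \<subseteq> W - {x}" "y \<in> ?U" using reach_subset[OF y] reach_self by auto
    have fin: "finite ?U" using U less.prems finite_subset by blast
    have c: "card (W - ?U) + card ?U = card W"
    proof -
      have "?U \<subseteq> W" using U by blast
      then show ?thesis using card_Diff_subset[OF fin, of W] card_mono[OF less(2), of ?U] by linarith
    qed
    have lt: "card ?U < card W" "card (W - ?U) < card W"
      using U less.prems xy x by (auto intro!: psubset_card_mono)
    have 1: "(\<Sum>v\<in>?U. card (nb ?U v)) + 2 = 2 * card ?U"
      using less(1)[OF lt(1) fin conn_reach[OF y]] U by blast
    have 2: "(\<Sum>v\<in>W - ?U. card (nb (W - ?U) v)) + 2 = 2 * card (W - ?U)"
      using less(1)[OF lt(2)] conn_remove_branch[OF less(3) x xy] less(2) by blast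
    \<comment> \<open>Only the cut edge joins the two sides, so degrees change at \<open>x\<close>
      and \<open>y\<close> alone.\<close>
    have cross: "u = y \<and> v = x" if "u \<in> ?U" "v \<in> W - ?U" "adj u v" for u v
    proof -
      have "v = x" using reach_closed[of u "W - {x}" y v] that U by blast
      moreover have "u \<in> W - {x}" using that U by blast
      moreover have "reach (W - {x}) u \<inter> ?U \<noteq> {}" using that reach_self by blast
      ultimately show ?thesis
        using reach_attachment_unique[OF conn_singleton[of x], of x x u W y] that adj_sym xy y by blast
    qed
    have nbU: "nb W v = (if v = y then insert x (nb ?U v) else nb ?U v)" if "v \<in> ?U" for v
      using cross[OF that] that xy adj_sym U x by (auto simp: nb_def)
    have nbW: "nb W v = (if v = x then insert y (nb (W - ?U) v) else nb (W - ?U) v)"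
      if "v \<in> W - ?U" for v
      using cross[of _ v] that xy adj_sym U x by (auto simp: nb_def)
    have finn: "finite (nb X v)" if "finite X" for X v using that by (auto simp: nb_def)
    have "(\<Sum>v\<in>?U. card (nb W v)) = (\<Sum>v\<in>?U. card (nb ?U v) + (if v = y then 1 else 0))"
    proof (rule sum.cong)
      fix v assume "v \<in> ?U"
      moreover have "x \<notin> nb ?U v" using U by (auto simp: nb_def)
      ultimately show "card (nb W v) = card (nb ?U v) + (if v = y then 1 else 0)"
        using nbU[of v] finn[OF fin, of v] by auto
    qed simp
    also have "\<dots> = (\<Sum>v\<in>?U. card (nb ?U v)) + 1" using U fin by (simp add: sum.distrib)
    finally have 3: "(\<Sum>v\<in>?U. card (nb W v)) = (\<Sum>v\<in>?U. card (nb ?U v)) + 1" .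
    have "(\<Sum>v\<in>W - ?U. card (nb W v)) = (\<Sum>v\<in>W - ?U. card (nb (W - ?U) v) + (if v = x then 1 else 0))"
    proof (rule sum.cong)
      fix v assume "v \<in> W - ?U"
      moreover have "y \<notin> nb (W - ?U) v" using U by (auto simp: nb_def)
      ultimately show "card (nb W v) = card (nb (W - ?U) v) + (if v = x then 1 else 0)"
        using nbW[of v] finn[of "W - ?U" v] less(2) by auto
    qed simp
    also have "\<dots> = (\<Sum>v\<in>W - ?U. card (nb (W - ?U) v)) + 1" using U x less(2) by (subst sum.distrib) auto
    finally have 4: "(\<Sum>v\<in>W - ?U. card (nb W v)) = (\<Sum>v\<in>W - ?U. card (nb (W - ?U) v)) + 1" .
    have "(\<Sum>v\<in>W. card (nb W v)) = (\<Sum>v\<in>W - ?U. card (nb W v)) + (\<Sum>v\<in>?U. card (nb W v))"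
      using U less(2) by (intro sum.subset_diff) auto
    with 1 2 3 4 c show ?thesis by linarith
  qed
qed

section \<open>Odd blocks and extension of NTD-sets\<close>

text \<open>Certifies that \<open>S\<close> is an NTD-set of the subgraph induced by \<open>U\<close>. The set \<open>M\<close> may be smaller than
  the neighbourhood of \<open>S\<close>: any further neighbour lies in \<open>S\<close> and so comes with an adjacent one. This
  makes certificates closed under arbitrary unions.\<close>

definition cert :: "'a set \<Rightarrow> 'a set \<Rightarrow> 'a set \<Rightarrow> bool" where
  "cert U S M \<longleftrightarrow> S \<subseteq> U \<and> M \<subseteq> U \<and> U \<subseteq> S \<union> M \<and>
     (\<forall>m\<in>M. (\<exists>s\<in>S. adj m s) \<and> (\<exists>m'\<in>M. adj m m'))"

lemma cert_Un: "cert U S M \<Longrightarrow> cert U' S' M' \<Longrightarrow> cert (U \<union> U') (S \<union> S') (M \<union> M')"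
  unfolding cert_def by blast

text \<open>The path \<open>u, a, b\<close> is certified by \<open>{a, u}\<close>, and
  \<open>u\<close> is already paid for.\<close>

lemma cert_add_edge_at_dominator:
  assumes ct: "cert U S M" and "u \<in> S" "adj u a" "adj a b"
  shows "cert (U \<union> {a, b}) (insert a S) (M \<union> {u, a, b})"
proof -
  have "adj a u" "adj b a" "u \<in> U" using assms adj_sym by (auto simp: cert_def)
  then have "cert {u, a, b} {a, u} {u, a, b}" using assms by (auto simp: cert_def)
  from cert_Un[OF ct this] show ?thesis using assms \<open>u \<in> U\<close> by (simp add: insert_absorb)
qed

text \<open>Here the far end is chosen: \<open>b\<close> dominates \<open>a\<close>, and
  \<open>u\<close> serves as the partner of \<open>a\<close> within the neighbourhood.\<close>

lemma cert_add_edge_at_neighbour: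
  assumes ct: "cert U S M" and "u \<in> M" "adj u a" "adj a b"
  shows "cert (U \<union> {a, b}) (insert b S) (insert a M)"
proof -
  have "adj a u" using assms adj_sym by blast
  then show ?thesis using assms by (auto simp: cert_def)
qed

section \<open>The three kinds of odd blocks\<close>

definition edge_block :: "'a set \<Rightarrow> bool" where
  "edge_block B \<longleftrightarrow> (\<exists>p q. adj p q \<and> B = {p, q})"

definition claw :: "'a \<Rightarrow> 'a \<Rightarrow> 'a \<Rightarrow> 'a \<Rightarrow> bool" where
  "claw c l1 l2 l3 \<longleftrightarrow> distinct [c, l1, l2, l3] \<and> adj c l1 \<and> adj c l2 \<and> adj c l3 \<and>
     \<not> adj l1 l2 \<and> \<not> adj l1 l3 \<and> \<not> adj l2 l3"

definition claw_block :: "'a set \<Rightarrow> bool" where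
  "claw_block B \<longleftrightarrow> (\<exists>c l1 l2 l3. claw c l1 l2 l3 \<and> B = {c, l1, l2, l3})"

lemma card_edge_block: "edge_block B \<Longrightarrow> card B = 2 \<and> finite B"
proof -
  assume "edge_block B"
  then obtain p q where "adj p q" "B = {p, q}" by (auto simp: edge_block_def)
  moreover from this have "p \<noteq> q" using adj_irrefl by blast
  ultimately show "card B = 2 \<and> finite B" by simp
qed

lemma edge_block_other:
  assumes "edge_block B" "v \<in> B"
  obtains b where "B = {v, b}" "adj v b"
proof -
  obtain p q where pq: "adj p q" "B = {p, q}" using assms by (auto simp: edge_block_def)
  show thesis
  proof (cases "v = p")
    case True
    then show thesis using that[of q] pq by blast
  next
    case False
    then show thesis using that[of p] pq assms(2) adj_sym[OF pq(1)] by blast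
  qed
qed

lemma card_claw_block: "claw_block B \<Longrightarrow> card B = 4 \<and> finite B"
  by (auto simp: claw_block_def claw_def)

text \<open>The centre dominates all leaves and \<open>l\<close> dominates the centre, so two
  vertices are enough for a star of any size.\<close>

lemma cert_star:
  assumes "c \<in> B" "B \<subseteq> insert c (nb B c)" "l \<in> nb B c"
  shows "cert B {c, l} B"
proof -
  have "adj c l" "l \<in> B" using assms by (auto simp: nb_def)
  moreover have "m = c \<or> adj m c" if "m \<in> B" for m
    using subsetD[OF assms(2) that] adj_sym[of c m] by (auto simp: nb_def)
  ultimately show ?thesis using assms(1) unfolding cert_def by blast
qed

lemma odd_not_one: "odd (n::nat) \<Longrightarrow> n \<noteq> 1 \<Longrightarrow> n = 3 \<or> n \<ge> 5"
  by presburger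

text \<open>The cases are none, one, or several internal vertices: a \<open>K\<^sub>2\<close>, a
  star, or a block in which every vertex has an internal neighbour.\<close>

lemma odd_block_cases:
  assumes "odd_block B" "finite B"
  shows "edge_block B \<or> claw_block B \<or> (\<exists>S M. cert B S M \<and> 2 * card S + 2 \<le> card B)"
proof -
  have B: "B \<noteq> {}" "conn B" and odd: "\<And>x. x \<in> B \<Longrightarrow> odd (card (nb B x))"
    using assms by (auto simp: odd_block_def)
  have ex: "\<exists>y\<in>B. adj x y" if "x \<in> B" for x
  proof -
    have "nb B x \<noteq> {}" using odd[OF that] by auto
    then show ?thesis by (auto simp: nb_def)
  qed
  define I where "I = {x \<in> B. card (nb B x) \<noteq> 1}"
  have finI: "finite I" "I \<subseteq> B" using assms by (auto simp: I_def)
  have leaf: "z = y" if "x \<in> B" "x \<notin> I" "adj x y" "y \<in> B" "adj x z" "z \<in> B" for x y z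
  proof -
    have "card (nb B x) = 1" "y \<in> nb B x" "z \<in> nb B x" using that by (auto simp: I_def nb_def)
    then show ?thesis by (metis card_1_singletonE singletonD)
  qed
  have closed: "X = B" if "X \<subseteq> B" "X \<noteq> {}" "\<And>u v. u \<in> X \<Longrightarrow> v \<in> B \<Longrightarrow> adj u v \<Longrightarrow> v \<in> X" for X
    using conn_exit[OF B(2) that(1,2)] that(3) by blast
  consider "I = {}" | c where "I = {c}" | "card I \<ge> 2"
  proof -
    have "card I = 0 \<or> card I = 1 \<or> card I \<ge> 2" by linarith
    then show thesis using that finI by (metis card_0_eq card_1_singletonE)
  qed
  then show ?thesis
  proof cases
    case 1
    obtain v where v: "v \<in> B" using B by blast
    then obtain u where u: "u \<in> B" "adj v u" using ex by blast
    have "{v, u} = B"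
    proof (rule closed)
      fix a b assume "a \<in> {v, u}" "b \<in> B" "adj a b"
      then show "b \<in> {v, u}"
        using leaf[of v u b] leaf[of u v b] u v adj_sym[OF u(2)] 1 by blast
    qed (use u v in auto)
    then show ?thesis using u unfolding edge_block_def by metis
  next
    case (2 c)
    then have c: "c \<in> B" using finI by blast
    have star: "insert c (nb B c) = B"
    proof (rule closed)
      fix u v assume "u \<in> insert c (nb B c)" "v \<in> B" "adj u v"
      then show "v \<in> insert c (nb B c)"
        using leaf[of u c v] adj_sym[of c u] c 2 unfolding nb_def by blast
    qed (use c in \<open>auto simp: nb_def\<close>)
    have cn: "c \<notin> nb B c" "finite (nb B c)" using adj_irrefl assms by (auto simp: nb_def)
    have card: "card B = Suc (card (nb B c))" using star cn by (metis card_insert_disjoint)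
    have "card (nb B c) \<noteq> 1" "odd (card (nb B c))" using 2 odd c by (auto simp: I_def)
    then have "card (nb B c) = 3 \<or> card (nb B c) \<ge> 5" using odd_not_one by blast
    then show ?thesis
    proof
      assume "card (nb B c) = 3"
      then obtain l1 l2 l3 where l: "nb B c = {l1, l2, l3}" "l1 \<noteq> l2" "l1 \<noteq> l3" "l2 \<noteq> l3"
        by (auto simp: card_3_iff)
      have a: "adj c l1" "adj c l2" "adj c l3" and lB: "l1 \<in> B" "l2 \<in> B" "l3 \<in> B"
        using l by (auto simp: nb_def)
      have "\<not> adj x y" if "x \<in> nb B c" "y \<in> nb B c" for x y
        using leaf[of x c y] that adj_sym[of c x] c 2 cn unfolding nb_def by blast
      then have "claw c l1 l2 l3" using l a cn by (auto simp: claw_def)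
      moreover have "B = {c, l1, l2, l3}" using star l by blast
      ultimately show ?thesis by (auto simp: claw_block_def)
    next
      \<comment> \<open>With at least five leaves the order is at least 6, and two vertices
        suffice.\<close>
      assume 5: "card (nb B c) \<ge> 5"
      then obtain l where "l \<in> nb B c" by fastforce
      then have "cert B {c, l} B" using cert_star[OF c] star by blast
      moreover have "card {c, l} \<le> 2" by (simp add: card_insert_if)
      ultimately show ?thesis using 5 card by (intro disjI2 exI[of _ "{c, l}"] exI[of _ B]) auto
    qed
  next
    case 3
    \<comment> \<open>If all neighbours of \<open>v\<close> were leaves, \<open>B\<close> would be a
      star around \<open>v\<close> with at most one internal vertex.\<close>
    have "\<exists>s\<in>I. adj v s" if v: "v \<in> B" for v
    proof (rule ccontr)
      assume no: "\<not> ?thesis"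
      have "insert v (nb B v) = B"
      proof (rule closed)
        fix u w assume "u \<in> insert v (nb B v)" "w \<in> B" "adj u w"
        then show "w \<in> insert v (nb B v)"
          using leaf[of u v w] adj_sym[of v u] v no unfolding nb_def by blast
      qed (use v in \<open>auto simp: nb_def\<close>)
      then have "I \<subseteq> {v}" using no finI(2) by (auto simp: nb_def)
      then have "card I \<le> card {v}" by (intro card_mono) auto
      with 3 show False by simp
    qed
    then have "cert B I B" using finI ex unfolding cert_def by blast
    \<comment> \<open>Leaves have degree 1, and internal vertices have odd degree at least 3. Hence
      \<open>card B + 2 * card I\<close> is at most the degree sum
      \<open>2 * card B - 2\<close>.\<close>
    moreover have "2 * card I + 2 \<le> card B"
    proof -
      have "(\<Sum>x\<in>B. 1 + (if x \<in> I then 2 else 0)) \<le> (\<Sum>x\<in>B. card (nb B x))"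
      proof (rule sum_mono)
        fix x assume "x \<in> B"
        then have "odd (card (nb B x))" "x \<in> I \<Longrightarrow> card (nb B x) \<noteq> 1" using odd by (auto simp: I_def)
        then show "1 + (if x \<in> I then 2 else 0) \<le> card (nb B x)"
          using odd_not_one[of "card (nb B x)"] by (cases "x \<in> I") (auto simp: odd_pos Suc_leI)
      qed
      moreover have "(\<Sum>x\<in>B. 1 + (if x \<in> I then 2 else 0)) = card B + 2 * card I"
      proof -
        have "(\<Sum>x\<in>B. (if x \<in> I then 2 else 0)) = (\<Sum>x\<in>I. (2::nat))"
          using finI assms(2) by (subst sum.inter_restrict[symmetric]) (auto simp: Int_absorb1)
        then show ?thesis by (subst sum.distrib) simp
      qed
      ultimately show ?thesis using degree_sum[OF assms(2) B(2,1)] by linarith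
    qed
    ultimately show ?thesis by blast
  qed
qed

section \<open>Extending certificates block by block\<close>

text \<open>These are the sets that can be added to an adjacent certified set for half their order:
  by a certificate of their own, or as a \<open>K\<^sub>2\<close> with help from its
  neighbour.\<close>

definition tile :: "'a set \<Rightarrow> bool" where
  "tile B \<longleftrightarrow> finite B \<and> (edge_block B \<or> (\<exists>S M. cert B S M \<and> 2 * card S \<le> card B))"

lemma cert_claw:
  assumes "claw c l1 l2 l3" "l \<in> {l1, l2, l3}"
  shows "cert {c, l1, l2, l3} {c, l} {c, l1, l2, l3}"
proof (rule cert_star)
  show "{c, l1, l2, l3} \<subseteq> insert c (nb {c, l1, l2, l3} c)" "l \<in> nb {c, l1, l2, l3} c"
    using assms by (auto simp: claw_def nb_def)
qed simp

lemma claw_block_tile: "claw_block B \<Longrightarrow> tile B"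
proof -
  assume B: "claw_block B"
  then obtain c l1 l2 l3 where c: "claw c l1 l2 l3" "B = {c, l1, l2, l3}"
    by (auto simp: claw_block_def)
  have "card {c, l1} \<le> 2" by (simp add: card_insert_if)
  then show "tile B" unfolding tile_def
    using card_claw_block[OF B] cert_claw[OF c(1), of l1, folded c(2)] by fastforce
qed

text \<open>While blocks are missing, connectedness provides one adjacent to the certified part. The
  inequality compares excesses without subtraction, and \<open>S \<subseteq> S'\<close> preserves a
  prescribed dominator.\<close>

lemma cert_extend:
  assumes "finite P" "pairwise disjnt P" "\<forall>B\<in>P. tile B" "conn (\<Union>P)"
    and "Q \<subseteq> P" "\<Union>Q \<noteq> {}" "cert (\<Union>Q) S M"
  shows "\<exists>S' M'. cert (\<Union>P) S' M' \<and> S \<subseteq> S' \<and> 2 * card S' + card (\<Union>Q) \<le> 2 * card S + card (\<Union>P)"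
  using assms(5-7)
proof (induction "card (P - Q)" arbitrary: Q S M rule: less_induct)
  case less
  show ?case
  proof (cases "\<Union>Q = \<Union>P")
    case True
    then show ?thesis using less.prems by (intro exI[of _ S] exI[of _ M]) auto
  next
    case False
    then obtain u v where uv: "u \<in> \<Union>Q" "v \<in> \<Union>P - \<Union>Q" "adj u v"
      using conn_exit[OF assms(4), of "\<Union>Q"] less.prems by blast
    then obtain B where B: "B \<in> P" "B \<notin> Q" "v \<in> B" by blast
    have fin: "finite (\<Union>P)" using assms by (auto simp: tile_def)
    have finQ: "finite (\<Union>Q)" using less.prems fin by (meson Union_mono finite_subset)
    have finS: "finite S" using less.prems finQ by (auto simp: cert_def intro: finite_subset)
    have disj: "\<Union>Q \<inter> B = {}"
    proof -
      have "C \<inter> B = {}" if "C \<in> Q" for C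
        using pairwiseD[OF assms(2), of C B] that B less.prems(1) by (auto simp: disjnt_def)
      then show ?thesis by blast
    qed
    have finB: "finite B" using B assms by (auto simp: tile_def)
    have cardU: "card (\<Union>(insert B Q)) = card (\<Union>Q) + card B"
      using card_Un_disjoint[OF finQ finB disj] by (simp add: Un_commute)
    have "\<exists>S' M'. cert (\<Union>(insert B Q)) S' M' \<and> S \<subseteq> S' \<and> 2 * card S' \<le> 2 * card S + card B"
    proof (cases "edge_block B")
      case True
      then obtain b where b: "B = {v, b}" "adj v b" using edge_block_other[OF True B(3)] by blast
      have U: "\<Union>(insert B Q) = \<Union>Q \<union> {v, b}" using b by auto
      have cB: "card B = 2" using True card_edge_block by blast
      \<comment> \<open>Which end of the \<open>K\<^sub>2\<close> joins \<open>S\<close> depends on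
        the role of \<open>u\<close>.\<close>
      have "u \<in> S \<or> u \<in> M" using uv less.prems by (auto simp: cert_def)
      then have "\<exists>z. \<exists>M'. cert (\<Union>Q \<union> {v, b}) (insert z S) M'"
        using cert_add_edge_at_dominator[OF less.prems(3) _ uv(3) b(2)]
          cert_add_edge_at_neighbour[OF less.prems(3) _ uv(3) b(2)] by blast
      then obtain z M' where "cert (\<Union>Q \<union> {v, b}) (insert z S) M'" by blast
      moreover have "card (insert z S) \<le> card S + 1" using finS by (simp add: card_insert_if)
      ultimately show ?thesis unfolding U using cB by (intro exI[of _ "insert z S"] exI[of _ M']) auto
    next
      case False
      then obtain SB MB where SB: "cert B SB MB" "2 * card SB \<le> card B"
        using B(1) assms(3) unfolding tile_def by blast
      have "cert (\<Union>(insert B Q)) (S \<union> SB) (M \<union> MB)"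
        using cert_Un[OF less.prems(3) SB(1)] by (simp add: Un_commute)
      moreover have "card (S \<union> SB) \<le> card S + card SB" by (rule card_Un_le)
      ultimately show ?thesis using SB by (intro exI[of _ "S \<union> SB"] exI[of _ "M \<union> MB"]) auto
    qed
    then obtain S1 M1 where S1: "cert (\<Union>(insert B Q)) S1 M1" "S \<subseteq> S1"
      "2 * card S1 \<le> 2 * card S + card B" by blast
    have "card (P - insert B Q) < card (P - Q)"
      using B assms(1) by (intro psubset_card_mono) auto
    from less.hyps[OF this _ _ S1(1)] B less.prems obtain S' M' where
      "cert (\<Union>P) S' M'" "S1 \<subseteq> S'" "2 * card S' + card (\<Union>(insert B Q)) \<le> 2 * card S1 + card (\<Union>P)"
      by blast
    then show ?thesis using S1 cardU by (intro exI[of _ S'] exI[of _ M']) auto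
  qed
qed

lemma edge_block_tile: "edge_block B \<Longrightarrow> tile B"
  using card_edge_block by (auto simp: tile_def)

text \<open>It is enough to find a start with \<open>u\<close> in its certificate and let it grow. A
  claw is a start by itself; a \<open>K\<^sub>2\<close> is taken together with an adjacent block,
  which exists because the order is not 2.\<close>

lemma cert_containing:
  assumes P: "finite P" "pairwise disjnt P" "\<forall>B\<in>P. edge_block B \<or> claw_block B" "conn (\<Union>P)"
    and u: "u \<in> \<Union>P" and card: "card (\<Union>P) \<noteq> 2"
  shows "\<exists>S M. cert (\<Union>P) S M \<and> u \<in> S \<and> 2 * card S \<le> card (\<Union>P)"
proof -
  have tiles: "\<forall>B\<in>P. tile B" using P claw_block_tile edge_block_tile by blast
  have "\<exists>Q S M. Q \<subseteq> P \<and> \<Union>Q \<noteq> {} \<and> cert (\<Union>Q) S M \<and> u \<in> S \<and> 2 * card S \<le> card (\<Union>Q)"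
  proof -
    obtain B where B: "B \<in> P" "u \<in> B" using u by blast
    show ?thesis
    proof (cases "claw_block B")
      case True
      then obtain c l1 l2 l3 where c: "claw c l1 l2 l3" "B = {c, l1, l2, l3}"
        by (auto simp: claw_block_def)
      then obtain l where "u \<in> {c, l}" "l \<in> {l1, l2, l3}" using B by blast
      moreover have "card {c, l} \<le> 2" by (simp add: card_insert_if)
      ultimately show ?thesis using cert_claw[OF c(1), of l] B c(2) card_claw_block[OF True]
        by (intro exI[of _ "{B}"] exI[of _ "{c, l}"] exI[of _ B]) auto
    next
      case False
      then have eB: "edge_block B" using P B by blast
      then have "B \<noteq> \<Union>P" "B \<noteq> {}" "B \<subseteq> \<Union>P" using card card_edge_block B by auto
      then obtain p w where pw: "p \<in> B" "w \<in> \<Union>P - B" "adj p w" using conn_exit[OF P(4)] by metis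
      then obtain p' where p': "B = {p, p'}" "adj p p'" using edge_block_other[OF eB pw(1)] by blast
      obtain D where D: "D \<in> P" "w \<in> D" "D \<noteq> B" using pw by blast
      have disj: "B \<inter> D = {}" using P(2) D B by (auto simp: pairwise_def disjnt_def)
      have U: "\<Union>{B, D} = D \<union> {p, p'}" using p' by blast
      have "finite B" "finite D" using tiles B D by (auto simp: tile_def)
      then have cU: "card (\<Union>{B, D}) = card D + 2"
        using disj card_edge_block[OF eB] by (simp add: card_Un_disjoint)
      have "\<exists>S M. cert (\<Union>{B, D}) S M \<and> u \<in> S \<and> 2 * card S \<le> card (\<Union>{B, D})"
      proof (cases "claw_block D")
        case True
        then obtain c l1 l2 l3 where c: "claw c l1 l2 l3" "D = {c, l1, l2, l3}"
          by (auto simp: claw_block_def)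
        \<comment> \<open>With this \<open>l\<close>, the contact vertex \<open>w\<close> lies both
          in \<open>S\<close> and in \<open>M\<close>, so both ways of adding \<open>p, p'\<close>
          are open and either end can be put into \<open>S\<close>.\<close>
        then obtain l where l: "w \<in> {c, l}" "l \<in> {l1, l2, l3}" using D by blast
        note ct = cert_claw[OF c(1) l(2), folded c(2)]
        have "cert (D \<union> {p, p'}) (insert p {c, l}) (D \<union> {w, p, p'})"
          using cert_add_edge_at_dominator[OF ct l(1) adj_sym[OF pw(3)] p'(2)] .
        moreover have "cert (D \<union> {p, p'}) (insert p' {c, l}) (insert p D)"
          using cert_add_edge_at_neighbour[OF ct D(2) adj_sym[OF pw(3)] p'(2)] .
        moreover have "u = p \<or> u = p'" using B p' by blast
        ultimately obtain M where "cert (D \<union> {p, p'}) (insert u {c, l}) M" by blast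
        moreover have "card (insert u {c, l}) \<le> 3" by (simp add: card_insert_if)
        ultimately show ?thesis unfolding U using cU card_claw_block[OF True] U
          by (intro exI[of _ "insert u {c, l}"] exI[of _ M]) auto
      next
        case False
        then have eD: "edge_block D" using P D by blast
        then obtain w' where w': "D = {w, w'}" "adj w w'" using edge_block_other[OF eD D(2)] by blast
        \<comment> \<open>On the path \<open>p', p, w, w'\<close> both the two inner and the two
          outer vertices work, so each of \<open>p\<close>, \<open>p'\<close> occurs in some
          certificate.\<close>
        have 1: "cert (D \<union> {p, p'}) {p, w} {p, p', w, w'}"
          using w' p' pw adj_sym[of p w] adj_sym[of p p'] adj_sym[of w w'] by (auto simp: cert_def)
        have 2: "cert (D \<union> {p, p'}) {p', w'} {p, w}"
          using w' p' pw adj_sym[of p w] adj_sym[of p p'] adj_sym[of w w'] by (auto simp: cert_def)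
        have "card {p, w} \<le> 2" "card {p', w'} \<le> 2" by (simp_all add: card_insert_if)
        moreover have "u = p \<or> u = p'" using B p' by blast
        moreover have "card (D \<union> {p, p'}) = 4" using cU card_edge_block[OF eD] U by simp
        ultimately show ?thesis unfolding U using 1 2 by fastforce
      qed
      then show ?thesis using B D by (intro exI[of _ "{B, D}"]) auto
    qed
  qed
  then obtain Q S M where Q: "Q \<subseteq> P" "\<Union>Q \<noteq> {}" "cert (\<Union>Q) S M" "u \<in> S" "2 * card S \<le> card (\<Union>Q)"
    by blast
  from cert_extend[OF P(1,2) tiles P(4) Q(1-3)] obtain S' M' where
    "cert (\<Union>P) S' M'" "S \<subseteq> S'" "2 * card S' + card (\<Union>Q) \<le> 2 * card S + card (\<Union>P)" by blast
  then show ?thesis using Q by (intro exI[of _ S'] exI[of _ M']) auto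
qed

lemma cert_ntd_set:
  assumes adj: "\<And>u v. adj u v \<longleftrightarrow> {u, v} \<in> E \<and> u \<noteq> v" and ct: "cert V S M"
  shows "ntd_set V E S"
proof -
  have N: "u \<in> nbhd_set E S \<longleftrightarrow> (\<exists>s\<in>S. adj u s)" for u
    by (auto simp: nbhd_set_def nbhd_def adj)
  have "nbhd_set E S \<union> S = V"
    using ct N adjV unfolding cert_def by blast
  moreover have "\<exists>w\<in>nbhd_set E S. adj u w" if u: "u \<in> nbhd_set E S" for u
  proof (cases "u \<in> M")
    case True
    then obtain m where "m \<in> M" "adj u m" using ct unfolding cert_def by blast
    then show ?thesis using ct N[of m] unfolding cert_def by blast
  next
    case False
    obtain s where s: "s \<in> S" "adj u s" using u N[of u] by blast
    have "u \<in> S" using ct False adjV[OF s(2)] unfolding cert_def by blast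
    then show ?thesis using s adj_sym[OF s(2)] N[of s] by blast
  qed
  ultimately show ?thesis using ct unfolding ntd_set_def dominating_def cert_def adj by blast
qed

end

section \<open>Branches at the blocks of an extremal tree\<close>

lemma card_Un_disjoint3:
  assumes "finite A" "finite B" "finite C" "A \<inter> B = {}" "A \<inter> C = {}" "B \<inter> C = {}"
  shows "card (A \<union> B \<union> C) = card A + card B + card C"
  using assms by (simp add: card_Un_disjoint Int_Un_distrib2)

text \<open>Extremality enters only as \<open>tight\<close>, which lets every configuration be
  examined locally.\<close>

locale tiled_tree = tree_adj +
  fixes P :: "'a set set"
  assumes connV: "conn V"
    and UnP: "\<Union>P = V" and disjP: "pairwise disjnt P"
    and block: "B \<in> P \<Longrightarrow> edge_block B \<or> claw_block B" and conn_block: "B \<in> P \<Longrightarrow> conn B"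
    and tight: "Q \<subseteq> P \<Longrightarrow> \<Union>Q \<noteq> {} \<Longrightarrow> cert (\<Union>Q) S M \<Longrightarrow> card (\<Union>Q) \<le> 2 * card S"
begin

lemma finP: "finite P"
  using finV UnP finite_UnionD by metis

lemma block_subset: "B \<in> P \<Longrightarrow> B \<subseteq> V" using UnP by blast

lemma block_eq: "B \<in> P \<Longrightarrow> C \<in> P \<Longrightarrow> v \<in> B \<Longrightarrow> v \<in> C \<Longrightarrow> B = C"
  using disjP by (auto simp: pairwise_def disjnt_def)

section \<open>Branches at a block\<close>

definition branch :: "'a set \<Rightarrow> 'a \<Rightarrow> 'a set" where
  "branch B w = reach (V - B) w"

definition outer :: "'a set \<Rightarrow> 'a \<Rightarrow> bool" where
  "outer B y \<longleftrightarrow> (\<exists>w. w \<notin> B \<and> adj y w)"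

text \<open>A branch of order 2 is a pendant \<open>P\<^sub>2\<close>, the exception in
  \<open>cert_containing\<close>. The property also holds if no branch is attached at
  \<open>y\<close>.\<close>

definition trivial_at :: "'a set \<Rightarrow> 'a \<Rightarrow> bool" where
  "trivial_at B y \<longleftrightarrow> (\<forall>w. w \<notin> B \<longrightarrow> adj y w \<longrightarrow> card (branch B w) = 2)"

lemma not_trivial_outer: "\<not> trivial_at B y \<Longrightarrow> outer B y"
  by (auto simp: trivial_at_def outer_def)

lemma branch_subset: "w \<in> V - B \<Longrightarrow> branch B w \<subseteq> V - B"
  unfolding branch_def by (rule reach_subset)

lemma branch_self: "w \<in> branch B w"
  unfolding branch_def by (rule reach_self)

lemma finite_branch: "w \<in> V - B \<Longrightarrow> finite (branch B w)"
  using branch_subset finV by (meson finite_Diff finite_subset)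

text \<open>A block that meets the branch is connected and disjoint from \<open>B\<close>, so it
  stays inside. This makes \<open>tight\<close> applicable to a block together with some of its
  branches.\<close>

lemma branch_is_union:
  assumes "B \<in> P" "w \<in> V - B"
  shows "\<exists>Q. Q \<subseteq> P \<and> \<Union>Q = branch B w"
proof (intro exI conjI)
  let ?Q = "{C \<in> P. C \<subseteq> branch B w}"
  show "?Q \<subseteq> P" by blast
  show "\<Union>?Q = branch B w"
  proof
    show "branch B w \<subseteq> \<Union>?Q"
    proof
      fix v assume v: "v \<in> branch B w"
      then have "v \<in> V - B" using branch_subset assms by blast
      then obtain C where C: "C \<in> P" "v \<in> C" using UnP by blast
      then have "C \<subseteq> V - B" using block_eq[OF assms(1)] block_subset \<open>v \<in> V - B\<close> by blast
      then have "C \<subseteq> branch B w"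
        using conn_subset_reach[OF conn_block[OF C(1)] _ C(2)] v unfolding branch_def by blast
      with C show "v \<in> \<Union>?Q" by blast
    qed
  qed blast
qed

lemma conn_branch: "w \<in> V - B \<Longrightarrow> conn (branch B w)"
  unfolding branch_def by (rule conn_reach)

lemma branch_dominator:
  assumes "B \<in> P" "w \<in> V - B" "card (branch B w) \<noteq> 2" "u \<in> branch B w"
  obtains S M where "cert (branch B w) S M" "u \<in> S" "2 * card S \<le> card (branch B w)"
proof -
  obtain Q where Q: "Q \<subseteq> P" "\<Union>Q = branch B w" using branch_is_union[OF assms(1,2)] by blast
  have "finite Q" using Q finP finite_subset by blast
  moreover have "pairwise disjnt Q" using Q disjP pairwise_subset by blast
  ultimately show thesis
    using cert_containing[of Q u, unfolded Q(2)] block Q(1) conn_branch[OF assms(2)] assms(3,4) that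
    by blast
qed

lemma block_neighbour:
  assumes "B \<in> P" "v \<in> B" obtains b where "b \<in> B" "adj v b"
proof -
  have "card B \<noteq> 1" using block[OF assms(1)] card_edge_block[of B] card_claw_block[of B] by auto
  then have "B \<noteq> {v}" by auto
  then show thesis using conn_exit[OF conn_block[OF assms(1)], of "{v}"] assms(2) that by blast
qed

lemma branch_of_card_2:
  assumes "B \<in> P" "w \<in> V - B" "card (branch B w) = 2"
  obtains b where "branch B w = {w, b}" "adj w b" "branch B w \<in> P"
proof -
  obtain Q where Q: "Q \<subseteq> P" "\<Union>Q = branch B w" using branch_is_union[OF assms(1,2)] by blast
  then obtain C where C: "C \<in> Q" "w \<in> C" using branch_self by blast
  have CP: "C \<in> P" using Q C by blast
  have "C \<subseteq> branch B w" using Q C by blast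
  moreover have "card C \<ge> 2" using block[OF CP] card_edge_block[of C] card_claw_block[of C] by auto
  ultimately have eq: "C = branch B w"
    using card_seteq[OF finite_branch[OF assms(2)]] assms(3) by simp
  then have "edge_block C" using block[OF CP] card_claw_block[of C] assms(3) by auto
  then obtain b where "C = {w, b}" "adj w b" using edge_block_other C(2) by blast
  then show thesis using that[of b] eq CP by simp
qed

text \<open>A certificate in which the partner of \<open>w\<close> is left open, to be supplied by
  the vertex of \<open>B\<close> next to \<open>w\<close>. With this relaxation a pendant
  \<open>P\<^sub>2\<close> costs only one vertex.\<close>

lemma branch_neighbour:
  assumes "B \<in> P" "w \<in> V - B"
  obtains S M where "S \<subseteq> branch B w" "M \<subseteq> branch B w" "branch B w \<subseteq> S \<union> M" "w \<in> M"
    "2 * card S \<le> card (branch B w)"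
    "\<forall>m\<in>M. (\<exists>s\<in>S. adj m s) \<and> (m = w \<or> (\<exists>m'\<in>M. adj m m'))"
proof (cases "card (branch B w) = 2")
  case True
  then obtain b where "branch B w = {w, b}" "adj w b" using branch_of_card_2 assms by blast
  then show thesis using that[of "{b}" "{w}"] True by auto
next
  case False
  obtain Q where Q: "Q \<subseteq> P" "\<Union>Q = branch B w" using branch_is_union[OF assms(1,2)] by blast
  then obtain C where C: "C \<in> Q" "w \<in> C" using branch_self by blast
  \<comment> \<open>A neighbour of \<open>w\<close> as prescribed dominator allows \<open>w\<close>
    to be added to \<open>M\<close>.\<close>
  then obtain w' where w': "w' \<in> C" "adj w w'" using block_neighbour Q by blast
  then have "w' \<in> branch B w" using Q C by blast
  then obtain S M where SM: "cert (branch B w) S M" "w' \<in> S" "2 * card S \<le> card (branch B w)"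
    using branch_dominator[OF assms False] by blast
  show thesis
  proof (rule that[of S "insert w M"])
    show "\<forall>m\<in>insert w M. (\<exists>s\<in>S. adj m s) \<and> (m = w \<or> (\<exists>m'\<in>insert w M. adj m m'))"
      using SM w'(2) unfolding cert_def by blast
  qed (use SM branch_self in \<open>auto simp: cert_def\<close>)
qed

lemma branches_disjoint:
  assumes "B \<in> P" "y1 \<in> B" "y2 \<in> B" "w1 \<in> V - B" "w2 \<in> V - B" "adj y1 w1" "adj y2 w2" "y1 \<noteq> y2"
  shows "branch B w1 \<inter> branch B w2 = {}"
  using reach_attachment_unique[OF conn_block[OF assms(1)], of y1 y2 w1 V w2] assms
  unfolding branch_def by blast

definition block_union :: "'a set \<Rightarrow> bool" where
  "block_union U \<longleftrightarrow> (\<exists>Q. Q \<subseteq> P \<and> \<Union>Q = U)"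

lemma block_union_Un: "block_union U \<Longrightarrow> block_union W \<Longrightarrow> block_union (U \<union> W)"
  unfolding block_union_def by (metis Un_subset_iff Union_Un_distrib)

lemma block_union_block: "B \<in> P \<Longrightarrow> block_union B"
  unfolding block_union_def by (intro exI[of _ "{B}"]) auto

lemma block_union_branch: "B \<in> P \<Longrightarrow> w \<in> V - B \<Longrightarrow> block_union (branch B w)"
  unfolding block_union_def by (rule branch_is_union)

lemma block_union_tight:
  assumes "block_union U" "U \<noteq> {}" "cert U S M" shows "card U \<le> 2 * card S"
  using assms tight unfolding block_union_def by blast

section \<open>Configurations excluded by tightness\<close>

text \<open>With \<open>w1\<close> and \<open>w2\<close> in the certificates of two non-trivial
  branches, \<open>p\<close> and \<open>q\<close> are dominated and are partners of each other: two
  vertices for free.\<close>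

lemma edge_block_one_trivial_end:
  assumes B: "{p, q} \<in> P" "adj p q"
  shows "trivial_at {p, q} p \<or> trivial_at {p, q} q"
proof (rule ccontr)
  let ?B = "{p, q}"
  assume "\<not> ?thesis"
  then obtain w1 w2 where w: "w1 \<notin> ?B" "w2 \<notin> ?B" and a: "adj p w1" "adj q w2"
    and c: "card (branch ?B w1) \<noteq> 2" "card (branch ?B w2) \<noteq> 2"
    by (auto simp: trivial_at_def)
  have wV: "w1 \<in> V - ?B" "w2 \<in> V - ?B" using w a adjV adj_sym by blast+
  have pq: "p \<noteq> q" using B adj_irrefl by blast
  let ?W1 = "branch ?B w1" and ?W2 = "branch ?B w2"
  obtain S1 M1 where S1: "cert ?W1 S1 M1" "w1 \<in> S1" "2 * card S1 \<le> card ?W1"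
    using branch_dominator[OF B(1) wV(1) c(1) branch_self] by blast
  obtain S2 M2 where S2: "cert ?W2 S2 M2" "w2 \<in> S2" "2 * card S2 \<le> card ?W2"
    using branch_dominator[OF B(1) wV(2) c(2) branch_self] by blast
  let ?U = "?B \<union> ?W1 \<union> ?W2"
  have "cert ?U (S1 \<union> S2) (M1 \<union> M2 \<union> ?B)"
    using S1(1,2) S2(1,2) a B(2) adj_sym[OF B(2)] unfolding cert_def by blast
  moreover have "block_union ?U"
    using block_union_Un block_union_block block_union_branch B wV by blast
  ultimately have "card ?U \<le> 2 * card (S1 \<union> S2)" using block_union_tight by blast
  moreover have "card ?U = 2 + card ?W1 + card ?W2"
  proof -
    have "?W1 \<inter> ?W2 = {}" using branches_disjoint[OF B(1) _ _ wV a pq] by blast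
    moreover have "?B \<inter> ?W1 = {}" "?B \<inter> ?W2 = {}"
      using branch_subset[OF wV(1)] branch_subset[OF wV(2)] by blast+
    ultimately show ?thesis
      using card_Un_disjoint3[of ?B ?W1 ?W2] finite_branch[OF wV(1)] finite_branch[OF wV(2)] pq by simp
  qed
  moreover have "card (S1 \<union> S2) \<le> card S1 + card S2" by (rule card_Un_le)
  ultimately show False using S1 S2 by linarith
qed

text \<open>The vertex \<open>c\<close> alone pays for the claw: it dominates the leaves, and
  \<open>w\<close> dominates \<open>c\<close>.\<close>

lemma claw_centre_not_outer:
  assumes B: "{c, l1, l2, l3} \<in> P" and claw: "claw c l1 l2 l3"
  shows "\<not> outer {c, l1, l2, l3} c"
proof
  let ?B = "{c, l1, l2, l3}"
  assume "outer ?B c"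
  then obtain w where w: "w \<notin> ?B" "adj c w" by (auto simp: outer_def)
  have wV: "w \<in> V - ?B" using w adjV adj_sym by blast
  let ?W = "branch ?B w"
  have cl: "adj c l1" "adj c l2" "adj c l3" using claw by (auto simp: claw_def)
  note cl' = cl[THEN adj_sym]
  have "\<exists>S M. cert (?B \<union> ?W) (insert c S) M \<and> 2 * card S \<le> card ?W"
  proof (cases "card ?W = 2")
    \<comment> \<open>For a pendant \<open>P\<^sub>2\<close>, \<open>c\<close> and \<open>w\<close>
      dominate each other, so \<open>{c, w}\<close> handles all six vertices.\<close>
    case True
    then obtain b where b: "?W = {w, b}" "adj w b" using branch_of_card_2[OF B wV] by blast
    have "cert (?B \<union> ?W) {c, w} (?B \<union> ?W)"
      unfolding b(1) cert_def using cl cl' b(2) adj_sym[OF b(2)] w(2) adj_sym[OF w(2)] by blast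
    then show ?thesis using True by (intro exI[of _ "{w}"] exI[of _ "?B \<union> ?W"]) auto
  next
    case False
    then obtain S M where S: "cert ?W S M" "w \<in> S" "2 * card S \<le> card ?W"
      using branch_dominator[OF B wV _ branch_self] by blast
    then have "cert (?B \<union> ?W) (insert c S) (?B \<union> M)"
      unfolding cert_def using cl cl' w(2) by blast
    then show ?thesis using S by blast
  qed
  then obtain S M where S: "cert (?B \<union> ?W) (insert c S) M" "2 * card S \<le> card ?W" by blast
  have "block_union (?B \<union> ?W)" using block_union_Un block_union_block block_union_branch B wV by blast
  then have "card (?B \<union> ?W) \<le> 2 * card (insert c S)" using block_union_tight S by blast
  moreover have "card (insert c S) \<le> Suc (card S)"
    by (metis card.infinite card_insert_if finite_insert le_SucI order_refl zero_le)
  moreover have "card (?B \<union> ?W) = 4 + card ?W"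
  proof -
    have "?B \<inter> ?W = {}" using branch_subset[OF wV] by blast
    moreover have "card ?B = 4" using claw by (auto simp: claw_def)
    ultimately show ?thesis using finite_branch[OF wV] by (subst card_Un_disjoint) auto
  qed
  ultimately show False using S by linarith
qed

text \<open>Again \<open>c\<close> pays for the claw. It dominates the leaves but stays outside
  \<open>M\<close>; each leaf has its \<open>w\<close> as partner and is in turn the partner left
  open in \<open>branch_neighbour\<close>. Hence even trivial branches are excluded.\<close>

lemma claw_not_all_leaves_outer:
  assumes B: "{c, l1, l2, l3} \<in> P" and claw: "claw c l1 l2 l3"
  shows "\<not> (outer {c, l1, l2, l3} l1 \<and> outer {c, l1, l2, l3} l2 \<and> outer {c, l1, l2, l3} l3)"
proof
  let ?B = "{c, l1, l2, l3}"
  assume "outer ?B l1 \<and> outer ?B l2 \<and> outer ?B l3"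
  then obtain w1 w2 w3 where w: "w1 \<notin> ?B" "w2 \<notin> ?B" "w3 \<notin> ?B"
    and a: "adj l1 w1" "adj l2 w2" "adj l3 w3" by (auto simp: outer_def)
  have wV: "w1 \<in> V - ?B" "w2 \<in> V - ?B" "w3 \<in> V - ?B" using w a adjV adj_sym by blast+
  let ?W1 = "branch ?B w1" and ?W2 = "branch ?B w2" and ?W3 = "branch ?B w3"
  have cl: "adj c l1" "adj c l2" "adj c l3" "distinct [c, l1, l2, l3]" using claw by (auto simp: claw_def)
  note cl' = cl(1-3)[THEN adj_sym] and a' = a[THEN adj_sym]
  obtain S1 M1 where S1: "S1 \<subseteq> ?W1" "M1 \<subseteq> ?W1" "?W1 \<subseteq> S1 \<union> M1" "w1 \<in> M1" "2 * card S1 \<le> card ?W1"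
    "\<forall>m\<in>M1. (\<exists>s\<in>S1. adj m s) \<and> (m = w1 \<or> (\<exists>m'\<in>M1. adj m m'))"
    using branch_neighbour[OF B wV(1)] by blast
  obtain S2 M2 where S2: "S2 \<subseteq> ?W2" "M2 \<subseteq> ?W2" "?W2 \<subseteq> S2 \<union> M2" "w2 \<in> M2" "2 * card S2 \<le> card ?W2"
    "\<forall>m\<in>M2. (\<exists>s\<in>S2. adj m s) \<and> (m = w2 \<or> (\<exists>m'\<in>M2. adj m m'))"
    using branch_neighbour[OF B wV(2)] by blast
  obtain S3 M3 where S3: "S3 \<subseteq> ?W3" "M3 \<subseteq> ?W3" "?W3 \<subseteq> S3 \<union> M3" "w3 \<in> M3" "2 * card S3 \<le> card ?W3"
    "\<forall>m\<in>M3. (\<exists>s\<in>S3. adj m s) \<and> (m = w3 \<or> (\<exists>m'\<in>M3. adj m m'))"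
    using branch_neighbour[OF B wV(3)] by blast
  let ?U = "?B \<union> ?W1 \<union> ?W2 \<union> ?W3" and ?S = "{c} \<union> S1 \<union> S2 \<union> S3"
    and ?M = "{l1, l2, l3} \<union> M1 \<union> M2 \<union> M3"
  have "cert ?U ?S ?M"
    unfolding cert_def
  proof (intro conjI ballI)
    show "?S \<subseteq> ?U" using S1(1) S2(1) S3(1) by blast
    show "?M \<subseteq> ?U" using S1(2) S2(2) S3(2) by blast
    show "?U \<subseteq> ?S \<union> ?M" using S1(3) S2(3) S3(3) by blast
  next
    fix m assume m: "m \<in> ?M"
    show "\<exists>s\<in>?S. adj m s" using m S1(6) S2(6) S3(6) cl' by blast
    consider "m = l1 \<or> m = l2 \<or> m = l3" | "m = w1 \<or> m = w2 \<or> m = w3"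
      | "m \<in> M1" "m \<noteq> w1" | "m \<in> M2" "m \<noteq> w2" | "m \<in> M3" "m \<noteq> w3" using m by blast
    then show "\<exists>m'\<in>?M. adj m m'"
    proof cases
      case 1
      then show ?thesis using a S1(4) S2(4) S3(4) by blast
    next
      case 2
      then show ?thesis using a' by blast
    next
      case 3
      then show ?thesis using S1(6) by blast
    next
      case 4
      then show ?thesis using S2(6) by blast
    next
      case 5
      then show ?thesis using S3(6) by blast
    qed
  qed
  moreover have "block_union ?U"
    using block_union_Un block_union_block block_union_branch B wV by blast
  ultimately have "card ?U \<le> 2 * card ?S" using block_union_tight by blast
  moreover have "card ?U = 4 + card ?W1 + card ?W2 + card ?W3"
  proof -
    have "?W1 \<inter> ?W2 = {}" "?W1 \<inter> ?W3 = {}" "?W2 \<inter> ?W3 = {}"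
      using branches_disjoint[OF B, of l1 l2 w1 w2] branches_disjoint[OF B, of l1 l3 w1 w3]
        branches_disjoint[OF B, of l2 l3 w2 w3] wV a cl(4) by auto
    moreover have "?B \<inter> ?W1 = {}" "?B \<inter> ?W2 = {}" "?B \<inter> ?W3 = {}"
      using branch_subset[OF wV(1)] branch_subset[OF wV(2)] branch_subset[OF wV(3)] by blast+
    moreover have "card ?B = 4" using cl(4) by auto
    ultimately show ?thesis
      using card_Un_disjoint3[of "?B \<union> ?W1" ?W2 ?W3] card_Un_disjoint[of ?B ?W1]
        finite_branch[OF wV(1)] finite_branch[OF wV(2)] finite_branch[OF wV(3)]
      by (simp add: Int_Un_distrib2)
  qed
  moreover have "card ?S \<le> 1 + card S1 + card S2 + card S3"
    using card_Un_le[of "{c} \<union> S1 \<union> S2" S3] card_Un_le[of "{c} \<union> S1" S2] card_Un_le[of "{c}" S1]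
    by simp
  ultimately show False using S1(5) S2(5) S3(5) by linarith
qed

text \<open>Here \<open>l3\<close> pays for the claw: it dominates \<open>c\<close>, while
  \<open>w1\<close> and \<open>w2\<close> dominate \<open>l1\<close> and \<open>l2\<close>, whose
  common partner is \<open>c\<close>.\<close>

lemma claw_one_trivial_leaf:
  assumes B: "{c, l1, l2, l3} \<in> P" and claw: "claw c l1 l2 l3"
  shows "trivial_at {c, l1, l2, l3} l1 \<or> trivial_at {c, l1, l2, l3} l2"
proof (rule ccontr)
  let ?B = "{c, l1, l2, l3}"
  assume "\<not> ?thesis"
  then obtain w1 w2 where w: "w1 \<notin> ?B" "w2 \<notin> ?B" and a: "adj l1 w1" "adj l2 w2"
    and cd: "card (branch ?B w1) \<noteq> 2" "card (branch ?B w2) \<noteq> 2"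
    by (auto simp: trivial_at_def)
  have wV: "w1 \<in> V - ?B" "w2 \<in> V - ?B" using w a adjV adj_sym by blast+
  have cl: "adj c l1" "adj c l2" "adj c l3" "distinct [c, l1, l2, l3]" using claw by (auto simp: claw_def)
  note cl' = cl(1-3)[THEN adj_sym]
  let ?W1 = "branch ?B w1" and ?W2 = "branch ?B w2"
  obtain S1 M1 where S1: "cert ?W1 S1 M1" "w1 \<in> S1" "2 * card S1 \<le> card ?W1"
    using branch_dominator[OF B wV(1) cd(1) branch_self] by blast
  obtain S2 M2 where S2: "cert ?W2 S2 M2" "w2 \<in> S2" "2 * card S2 \<le> card ?W2"
    using branch_dominator[OF B wV(2) cd(2) branch_self] by blast
  let ?U = "?B \<union> ?W1 \<union> ?W2" and ?S = "{l3} \<union> S1 \<union> S2" and ?M = "{c, l1, l2} \<union> M1 \<union> M2"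
  have "cert ?U ?S ?M"
    using S1(1,2) S2(1,2) a cl cl' unfolding cert_def by blast
  moreover have "block_union ?U"
    using block_union_Un block_union_block block_union_branch B wV by blast
  ultimately have "card ?U \<le> 2 * card ?S" using block_union_tight by blast
  moreover have "card ?U = 4 + card ?W1 + card ?W2"
  proof -
    have "?W1 \<inter> ?W2 = {}" using branches_disjoint[OF B, of l1 l2 w1 w2] wV a cl(4) by auto
    moreover have "?B \<inter> ?W1 = {}" "?B \<inter> ?W2 = {}"
      using branch_subset[OF wV(1)] branch_subset[OF wV(2)] by blast+
    moreover have "card ?B = 4" using cl(4) by auto
    ultimately show ?thesis
      using card_Un_disjoint3[of ?B ?W1 ?W2] finite_branch[OF wV(1)] finite_branch[OF wV(2)] by simp
  qed
  moreover have "card ?S \<le> 1 + card S1 + card S2"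
    using card_Un_le[of "{l3} \<union> S1" S2] card_Un_le[of "{l3}" S1] by simp
  ultimately show False using S1(3) S2(3) by linarith
qed

section \<open>Choice of roots\<close>

text \<open>The root \<open>x\<close> may carry arbitrary branches. The last condition makes a block
  with a single outer vertex take it as root, so that a pendant \<open>P\<^sub>2\<close> hangs by
  its root.\<close>

definition rooted_edge :: "'a set \<Rightarrow> 'a \<Rightarrow> 'a \<Rightarrow> bool" where
  "rooted_edge B x x' \<longleftrightarrow> B = {x, x'} \<and> adj x x' \<and> trivial_at B x' \<and> (outer B x' \<longrightarrow> outer B x)"

definition rooted_claw :: "'a set \<Rightarrow> 'a \<Rightarrow> 'a \<Rightarrow> 'a \<Rightarrow> 'a \<Rightarrow> bool" where
  "rooted_claw B x c l m \<longleftrightarrow> B = {c, x, l, m} \<and> claw c x l m \<and> \<not> outer B c \<and> \<not> outer B m \<and>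
     trivial_at B l \<and> (outer B l \<longrightarrow> outer B x)"

text \<open>A vertex without branches is trivial, so the two can be exchanged if only the trivial
  one is outer.\<close>

lemma choose_root:
  assumes "trivial_at B p \<or> trivial_at B q"
  shows "(trivial_at B q \<and> (outer B q \<longrightarrow> outer B p)) \<or> (trivial_at B p \<and> (outer B p \<longrightarrow> outer B q))"
  using assms not_trivial_outer by blast

lemma claw_perm:
  "claw c l1 l2 l3 \<Longrightarrow> claw c l2 l1 l3" "claw c l1 l2 l3 \<Longrightarrow> claw c l1 l3 l2"
  unfolding claw_def using adj_sym[of l2 l1] adj_sym[of l3 l2] by auto

lemma rooted_block:
  assumes B: "B \<in> P"
  shows "(\<exists>x x'. rooted_edge B x x') \<or> (\<exists>x c l m. rooted_claw B x c l m)"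
  using block[OF B]
proof
  assume "edge_block B"
  then obtain p q where pq: "adj p q" "B = {p, q}" by (auto simp: edge_block_def)
  then have "trivial_at B p \<or> trivial_at B q" using edge_block_one_trivial_end B by blast
  from choose_root[OF this] have "rooted_edge B p q \<or> rooted_edge B q p"
    using pq adj_sym[OF pq(1)] unfolding rooted_edge_def by blast
  then show ?thesis by blast
next
  \<comment> \<open>Normal form: \<open>l3\<close> is the leaf without branches, and the root is one
    of the other two.\<close>
  have main: ?thesis if "claw c l1 l2 l3" "B = {c, l1, l2, l3}" "\<not> outer B l3" for c l1 l2 l3
  proof -
    have "\<not> outer B c" using claw_centre_not_outer that B by blast
    moreover have "trivial_at B l1 \<or> trivial_at B l2" using claw_one_trivial_leaf that B by blast
    ultimately have "rooted_claw B l1 c l2 l3 \<or> rooted_claw B l2 c l1 l3"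
      using choose_root[of B l1 l2] that claw_perm(1)[OF that(1)] unfolding rooted_claw_def by blast
    then show ?thesis by blast
  qed
  assume "claw_block B"
  then obtain c l1 l2 l3 where c: "claw c l1 l2 l3" "B = {c, l1, l2, l3}"
    by (auto simp: claw_block_def)
  then consider "\<not> outer B l1" | "\<not> outer B l2" | "\<not> outer B l3"
    using claw_not_all_leaves_outer B by blast
  then show ?thesis
  proof cases
    case 1
    then show ?thesis using main[of c l2 l3 l1] claw_perm c by blast
  next
    case 2
    then show ?thesis using main[of c l1 l3 l2] claw_perm c by blast
  next
    case 3
    then show ?thesis using main c by blast
  qed
qed

end

section \<open>Recovering the construction\<close>

text \<open>For a claw, \<open>rt\<close>, \<open>ct\<close>, \<open>lf\<close>, \<open>ml\<close> are the vertices \<open>x\<close>, \<open>g (x, 1)\<close>, \<open>g (x, 0)\<close>, \<open>g (x, 2)\<close> of the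
  construction, and for an edge \<open>rt\<close> and \<open>lf\<close> are \<open>x\<close> and \<open>g (x, 0)\<close>; only \<open>lf\<close> may carry pendant \<open>P\<^sub>2\<close>s.\<close>

locale rooted_tiling = tiled_tree +
  fixes E :: "'a set set" and rt lf ct ml :: "'a set \<Rightarrow> 'a"
  assumes E: "E = {{u, v} | u v. adj u v}"
    and nocycle: "\<not> (\<exists>xs. is_cycle E xs)"
    and V_ne: "V \<noteq> {}"
    and rooted: "B \<in> P \<Longrightarrow> rooted_edge B (rt B) (lf B) \<or> rooted_claw B (rt B) (ct B) (lf B) (ml B)"
begin

lemma edge_iff: "{u, v} \<in> E \<longleftrightarrow> adj u v"
proof
  assume "{u, v} \<in> E"
  then obtain a b where "{u, v} = {a, b}" "adj a b" unfolding E by blast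
  then show "adj u v" using adj_sym[of a b] by (auto simp: doubleton_eq_iff)
qed (auto simp: E)

lemma edgeE: assumes "e \<in> E" obtains u v where "e = {u, v}" "adj u v"
  using assms E by blast

section \<open>Legs and the blocks that carry them\<close>

definition blk :: "'a \<Rightarrow> 'a set" where
  "blk v = (THE B. B \<in> P \<and> v \<in> B)"

lemma blk_eq:
  assumes "B \<in> P" "v \<in> B" shows "blk v = B"
  unfolding blk_def
proof (rule the_equality)
  show "C = B" if "C \<in> P \<and> v \<in> C" for C using block_eq[of C B v] that assms by blast
qed (use assms in blast)

lemma blk: "v \<in> V \<Longrightarrow> blk v \<in> P \<and> v \<in> blk v"
proof -
  assume "v \<in> V"
  then obtain B where "B \<in> P" "v \<in> B" using UnP by blast
  then show ?thesis using blk_eq[of B v] by simp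
qed

definition is_edge :: "'a set \<Rightarrow> bool" where
  "is_edge B \<longleftrightarrow> rooted_edge B (rt B) (lf B)"

lemma is_edgeD:
  assumes "is_edge B"
  shows "v \<in> B \<longleftrightarrow> v \<in> {rt B, lf B}" "adj (rt B) (lf B)" "rt B \<noteq> lf B"
proof -
  have e: "B = {rt B, lf B}" "adj (rt B) (lf B)" using assms unfolding is_edge_def rooted_edge_def by blast+
  show "v \<in> B \<longleftrightarrow> v \<in> {rt B, lf B}" by (rule arg_cong[OF e(1)])
  show "adj (rt B) (lf B)" by (rule e(2))
  then show "rt B \<noteq> lf B" using adj_irrefl by metis
qed

lemma not_is_edgeD:
  assumes "B \<in> P" "\<not> is_edge B"
  shows "v \<in> B \<longleftrightarrow> v \<in> {ct B, rt B, lf B, ml B}" "claw (ct B) (rt B) (lf B) (ml B)"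
    "distinct [ct B, rt B, lf B, ml B]" "\<not> outer B (ct B)" "\<not> outer B (ml B)" "card B = 4"
proof -
  have r: "rooted_claw B (rt B) (ct B) (lf B) (ml B)"
    using rooted[OF assms(1)] assms(2) unfolding is_edge_def by blast
  then have e: "B = {ct B, rt B, lf B, ml B}" unfolding rooted_claw_def by blast
  show "v \<in> B \<longleftrightarrow> v \<in> {ct B, rt B, lf B, ml B}" by (rule arg_cong[OF e])
  show c: "claw (ct B) (rt B) (lf B) (ml B)" "\<not> outer B (ct B)" "\<not> outer B (ml B)"
    using r unfolding rooted_claw_def by blast+
  then show "distinct [ct B, rt B, lf B, ml B]" unfolding claw_def by blast
  have "claw_block B" unfolding claw_block_def using c(1) e by blast
  then show "card B = 4" using card_claw_block by blast
qed

lemma rt_lf: "B \<in> P \<Longrightarrow> rt B \<in> B \<and> lf B \<in> B \<and> rt B \<noteq> lf B"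
  using is_edgeD[of B] not_is_edgeD[of B] by (cases "is_edge B") auto

lemma trivial_lf: "B \<in> P \<Longrightarrow> trivial_at B (lf B)"
  using rooted[of B] unfolding rooted_edge_def rooted_claw_def by blast

lemma outer_lf_rt: "B \<in> P \<Longrightarrow> outer B (lf B) \<Longrightarrow> outer B (rt B)"
  using rooted[of B] unfolding rooted_edge_def rooted_claw_def by blast

lemma outer_cases:
  assumes "B \<in> P" "y \<in> B" "w \<notin> B" "adj y w"
  shows "y = rt B \<or> y = lf B"
proof -
  have "outer B y" using assms by (auto simp: outer_def)
  then show ?thesis
    using is_edgeD(1)[of B y] not_is_edgeD(1)[OF assms(1), of y] not_is_edgeD(4,5)[OF assms(1)] assms(2)
    by (cases "is_edge B") auto
qed

text \<open>The legs will be the copies of \<open>P\<^sub>2\<close> added in the second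
  step.\<close>

definition leg :: "'a set \<Rightarrow> bool" where
  "leg D \<longleftrightarrow> D \<in> P \<and> (\<exists>B\<in>P. \<exists>w\<in>D. w \<notin> B \<and> adj (lf B) w)"

text \<open>As \<open>lf B\<close> is trivial, the branch at \<open>w\<close> has order 2 and
  therefore equals \<open>D\<close>. Uniqueness of the attachment leaves one edge out of
  \<open>D\<close>.\<close>

lemma leg_props:
  assumes D: "D \<in> P" "w \<in> D" and B: "B \<in> P" "w \<notin> B" "adj (lf B) w"
  shows "rt D = w" "is_edge D" "\<And>v z. v \<in> D \<Longrightarrow> z \<notin> D \<Longrightarrow> adj v z \<Longrightarrow> v = w \<and> z = lf B"
proof -
  have wV: "w \<in> V - B" using D block_subset B by blast
  have "card (branch B w) = 2" using trivial_lf[OF B(1)] B by (auto simp: trivial_at_def)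
  then obtain b where b: "branch B w = {w, b}" "adj w b" "branch B w \<in> P"
    using branch_of_card_2[OF B(1) wV] by blast
  have DW: "D = branch B w" using block_eq[OF D(1) b(3) D(2) branch_self] .
  show out: "v = w \<and> z = lf B" if v: "v \<in> D" "z \<notin> D" "adj v z" for v z
  proof -
    have vV: "v \<in> V - B" using branch_subset[OF wV] v DW by blast
    have "z \<in> B"
    proof (rule ccontr)
      assume "z \<notin> B"
      then have "z \<in> V - B" using v adjV adj_sym by blast
      then have "z \<in> D" using reach_closed[of v "V - B" w z] v vV DW unfolding branch_def by blast
      with v show False by blast
    qed
    moreover have "reach (V - B) w \<inter> reach (V - B) v \<noteq> {}"
      using v DW reach_self unfolding branch_def by blast
    ultimately show ?thesis
      using reach_attachment_unique[OF conn_block[OF B(1)], of "lf B" z w V v] rt_lf[OF B(1)] wV vV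
        B(3) adj_sym[OF v(3)] by blast
  qed
  have lfD: "lf B \<notin> D" using DW branch_subset[OF wV] rt_lf[OF B(1)] by blast
  then have ow: "outer D w" using adj_sym[OF B(3)] by (auto simp: outer_def)
  show "rt D = w"
  proof -
    \<comment> \<open>In both cases \<open>rt D\<close> is outer, and \<open>w\<close> is the only
      outer vertex of \<open>D\<close>.\<close>
    have "w = rt D \<or> w = lf D" using outer_cases[OF D lfD adj_sym[OF B(3)]] .
    then have "outer D (rt D)" using ow outer_lf_rt[OF D(1)] by blast
    then show ?thesis using out[of "rt D"] rt_lf[OF D(1)] by (auto simp: outer_def)
  qed
  show "is_edge D"
  proof (rule ccontr)
    assume "\<not> is_edge D"
    then have "card D = 4" using not_is_edgeD(6)[OF D(1)] by blast
    then show False using DW \<open>card (branch B w) = 2\<close> by simp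
  qed
qed

definition base :: "'a set set" where
  "base = {B \<in> P. \<not> leg B}"

lemma leg_host:
  assumes "leg D"
  obtains B where "B \<in> base" "adj (lf B) (rt D)" "rt D \<notin> B" "D \<in> P" "is_edge D"
    "\<And>v z. v \<in> D \<Longrightarrow> z \<notin> D \<Longrightarrow> adj v z \<Longrightarrow> v = rt D \<and> z = lf B"
proof -
  obtain B w where D: "D \<in> P" "w \<in> D" and B: "B \<in> P" "w \<notin> B" "adj (lf B) w"
    using assms by (auto simp: leg_def)
  note p = leg_props[OF D B]
  \<comment> \<open>Legs are not nested: a leg is left only from its root, whereas \<open>B\<close>
    is left from \<open>lf B\<close>.\<close>
  have "\<not> leg B"
  proof
    assume "leg B"
    then obtain C z where "B \<in> P" "z \<in> B" "C \<in> P" "z \<notin> C" "adj (lf C) z" by (auto simp: leg_def)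
    note q = leg_props[OF this]
    have "lf B = rt B" using q(1) q(3)[of "lf B" w] B rt_lf[OF B(1)] by blast
    then show False using rt_lf[OF B(1)] by simp
  qed
  then have "B \<in> base" using B by (simp add: base_def)
  then show thesis using that[of B] B D p by simp
qed

lemma leg_of_lf_neighbour:
  assumes "B \<in> P" "w \<notin> B" "adj (lf B) w"
  shows "leg (blk w)" "rt (blk w) = w"
proof -
  have "w \<in> V" using assms adjV adj_sym by blast
  then have D: "blk w \<in> P" "w \<in> blk w" using blk by auto
  show "rt (blk w) = w" using leg_props(1)[OF D assms] .
  show "leg (blk w)" using D assms by (auto simp: leg_def)
qed

text \<open>An edge leaving a block at \<open>lf\<close> leads to a leg, so base blocks meet only
  root to root.\<close>

lemma base_cross_edge:
  assumes "B \<in> base" "C \<in> base" "B \<noteq> C" "u \<in> B" "v \<in> C" "adj u v"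
  shows "u = rt B" "v = rt C"
proof -
  have main: "u = rt B" if "B \<in> base" "C \<in> base" "B \<noteq> C" "u \<in> B" "v \<in> C" "adj u v" for B C u v
  proof (rule ccontr)
    assume "u \<noteq> rt B"
    have B: "B \<in> P" "C \<in> P" "\<not> leg C" using that by (auto simp: base_def)
    have "v \<notin> B" using block_eq[of B C v] B that by blast
    moreover have "u = lf B" using outer_cases[OF B(1) that(4) \<open>v \<notin> B\<close> that(6)] \<open>u \<noteq> rt B\<close> by blast
    ultimately have "leg (blk v)" using leg_of_lf_neighbour[OF B(1)] that by blast
    then show False using blk_eq B that by metis
  qed
  show "u = rt B" using main[OF assms] .
  show "v = rt C" using main[of C B v u] assms adj_sym by blast
qed

lemma lf_base_neighbour:
  assumes "B \<in> base" "C \<in> base" "v \<in> C" "adj v (lf B)"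
  shows "C = B"
proof (rule ccontr)
  assume "C \<noteq> B"
  have "B \<in> P" using assms by (auto simp: base_def)
  then show False using base_cross_edge(2)[OF assms(2,1) \<open>C \<noteq> B\<close> assms(3) _ assms(4)] rt_lf by metis
qed

section \<open>The tree of roots\<close>

definition V0 :: "'a set" where "V0 = rt ` base"
definition E0 :: "'a set set" where "E0 = {e \<in> E. e \<subseteq> V0}"
definition V1 :: "'a set" where "V1 = \<Union>base"
definition E1 :: "'a set set" where "E1 = {e \<in> E. e \<subseteq> V1}"

definition hosts :: "'a set \<Rightarrow> 'a set \<Rightarrow> bool" where
  "hosts B D \<longleftrightarrow> B \<in> base \<and> (\<forall>v z. v \<in> D \<longrightarrow> z \<notin> D \<longrightarrow> adj v z \<longrightarrow> v = rt D \<and> z = lf B)"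

text \<open>With the identity on base blocks, \<open>rt (host (blk v))\<close> is a retraction of
  \<open>V\<close> onto \<open>V0\<close>.\<close>

definition host :: "'a set \<Rightarrow> 'a set" where
  "host D = (if leg D then SOME B. hosts B D else D)"

lemma host_leg:
  assumes "leg D"
  shows "host D \<in> base" "\<And>v z. v \<in> D \<Longrightarrow> z \<notin> D \<Longrightarrow> adj v z \<Longrightarrow> v = rt D \<and> z = lf (host D)"
proof -
  have "\<exists>B. hosts B D" using leg_host[OF assms] unfolding hosts_def by metis
  then have "hosts (host D) D" unfolding host_def using someI_ex[of "\<lambda>B. hosts B D"] assms by simp
  then show "host D \<in> base" "\<And>v z. v \<in> D \<Longrightarrow> z \<notin> D \<Longrightarrow> adj v z \<Longrightarrow> v = rt D \<and> z = lf (host D)"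
    unfolding hosts_def by blast+
qed

lemma host_base: "D \<in> P \<Longrightarrow> host D \<in> base"
  using host_leg(1) by (cases "leg D") (auto simp: host_def base_def)

lemma host_of_base: "D \<in> base \<Longrightarrow> host D = D"
  by (auto simp: host_def base_def)

text \<open>The retraction maps each edge to an edge of \<open>E0\<close> or to a point, so walks in
  \<open>V\<close> project to walks in \<open>V0\<close>. This gives connectedness of the tree of
  roots.\<close>

lemma host_step:
  assumes "adj u v"
  shows "(rt (host (blk u)), rt (host (blk v))) \<in> (adj_rel E0)\<^sup>*"
proof -
  have uv: "u \<in> V" "v \<in> V" using assms adjV adj_sym by blast+
  let ?B = "blk u" and ?C = "blk v"
  have B: "?B \<in> P" "u \<in> ?B" "?C \<in> P" "v \<in> ?C" using blk uv by auto
  have leg_case: "host D = host C" if "leg D" "D \<in> P" "C \<in> P" "D \<noteq> C" "x \<in> D" "y \<in> C" "adj x y" for D C x y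
  proof -
    have "y \<notin> D" using block_eq[of D C y] that by blast
    then have y: "y = lf (host D)" using host_leg(2)[OF that(1,5)] that by blast
    have new2: "host D \<in> base" using host_leg that by blast
    then have "lf (host D) \<in> host D" "host D \<in> P" using rt_lf[of "host D"] by (auto simp: base_def)
    then have "C = host D" using block_eq[of C "host D" y] that y by blast
    then show ?thesis using host_of_base new2 by simp
  qed
  show ?thesis
  proof (cases "?B = ?C")
    case False
    show ?thesis
    proof (cases "leg ?B \<or> leg ?C")
      case True
      then have "host ?B = host ?C"
        using leg_case[of ?B ?C u v] leg_case[of ?C ?B v u] B False assms adj_sym[OF assms] by metis
      then show ?thesis by simp
    next
      case False
      then have b: "?B \<in> base" "?C \<in> base" using B by (auto simp: base_def)
      then have "u = rt ?B" "v = rt ?C" using base_cross_edge \<open>?B \<noteq> ?C\<close> B assms by blast+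
      moreover have "host ?B = ?B" "host ?C = ?C" using b host_of_base by auto
      moreover have "rt ?B \<in> V0" "rt ?C \<in> V0" using b by (auto simp: V0_def)
      ultimately have "(rt (host ?B), rt (host ?C)) \<in> adj_rel E0"
        using assms edge_iff adj_irrefl by (auto simp: adj_rel_def E0_def)
      then show ?thesis by blast
    qed
  qed simp
qed

lemma V0_subset: "V0 \<subseteq> V"
proof
  fix x assume "x \<in> V0"
  then obtain B where "B \<in> P" "x = rt B" by (auto simp: V0_def base_def)
  then show "x \<in> V" using rt_lf[of B] block_subset[of B] by blast
qed

lemma tree_V0: "is_tree V0 E0"
  unfolding is_tree_def
proof (intro conjI)
  show "simple_graph V0 E0"
    unfolding simple_graph_def
  proof (intro conjI ballI)
    show "finite V0" using V0_subset finV finite_subset by blast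
    fix e assume "e \<in> E0"
    then have "e \<in> E" "e \<subseteq> V0" by (auto simp: E0_def)
    moreover from this obtain u v where "e = {u, v}" "adj u v" using edgeE by blast
    ultimately show "\<exists>u v. e = {u, v} \<and> u \<noteq> v \<and> u \<in> V0 \<and> v \<in> V0" using adj_irrefl by blast
  qed
  show "V0 \<noteq> {}"
  proof -
    obtain v where "v \<in> V" using V_ne by blast
    then have "host (blk v) \<in> base" using blk host_base by blast
    then show ?thesis by (auto simp: V0_def)
  qed
  show "\<not> (\<exists>xs. is_cycle E0 xs)"
    using nocycle by (auto simp: is_cycle_def E0_def)
  show "connected_graph V0 E0"
    unfolding connected_graph_def
  proof (intro ballI)
    fix x y assume xy: "x \<in> V0" "y \<in> V0"
    have fx: "rt (host (blk z)) = z" if z: "z \<in> V0" for z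
    proof -
      obtain B where B: "B \<in> base" "z = rt B" using z by (auto simp: V0_def)
      then have "blk z = B" using blk_eq[of B z] rt_lf[of B] by (auto simp: base_def)
      then show ?thesis using host_of_base B by simp
    qed
    have "(x, y) \<in> (rel V)\<^sup>*" using connV xy V0_subset by (auto simp: conn_def)
    then have "(rt (host (blk x)), rt (host (blk y))) \<in> (adj_rel E0)\<^sup>*"
    proof induction
      case (step y z)
      then have "adj y z" by (auto simp: rel_def)
      then show ?case using step.IH host_step rtrancl_trans by metis
    qed simp
    then show "(x, y) \<in> (adj_rel E0)\<^sup>*" using fx xy by simp
  qed
qed

section \<open>First step of the construction\<close>

definition edge_roots :: "'a set" where "edge_roots = {x \<in> V0. is_edge (blk x)}"

definition new1 :: "'a \<times> nat \<Rightarrow> 'a" where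
  "new1 = (\<lambda>(x, i). if i = 0 then lf (blk x) else if i = 1 then ct (blk x) else ml (blk x))"

lemma blk_rt: "B \<in> base \<Longrightarrow> blk (rt B) = B"
  using blk_eq[of B "rt B"] rt_lf[of B] by (auto simp: base_def)

lemma V0_E: assumes "x \<in> V0" obtains B where "B \<in> base" "B \<in> P" "x = rt B" "blk x = B"
proof -
  obtain B where "B \<in> base" "x = rt B" using assms by (auto simp: V0_def)
  then show thesis using that[of B] blk_rt[of B] by (auto simp: base_def)
qed

lemma rt_in_A: "B \<in> base \<Longrightarrow> rt B \<in> edge_roots \<longleftrightarrow> is_edge B"
  using blk_rt[of B] by (auto simp: edge_roots_def V0_def)

lemma new1_rt: "B \<in> base \<Longrightarrow> new1 (rt B, 0) = lf B" "B \<in> base \<Longrightarrow> new1 (rt B, 1) = ct B"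
  "B \<in> base \<Longrightarrow> new1 (rt B, Suc 0) = ct B"  "B \<in> base \<Longrightarrow> new1 (rt B, 2) = ml B"
  using blk_rt[of B] by (auto simp: new1_def)

definition slot :: "'a set \<Rightarrow> nat \<Rightarrow> bool" where
  "slot B i \<longleftrightarrow> (if is_edge B then i = 0 else i = 0 \<or> i = 1 \<or> i = 2)"

lemma step1_dom_base:
  "step1_dom V0 edge_roots = {(rt B, i) | B i. B \<in> base \<and> slot B i}"
proof -
  have lt3: "i < 3 \<longleftrightarrow> i = 0 \<or> i = 1 \<or> i = 2" for i :: nat by linarith
  have "(x, i) \<in> step1_dom V0 edge_roots \<longleftrightarrow> (\<exists>B. x = rt B \<and> B \<in> base \<and> slot B i)" for x i
    unfolding step1_dom_def V0_def lt3 slot_def using rt_in_A by fastforce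
  then show ?thesis by (intro set_eqI) (simp add: split_paired_all)
qed

lemma new1_props:
  assumes "B \<in> base" "slot B i"
  shows "new1 (rt B, i) \<in> B" "new1 (rt B, i) \<noteq> rt B"
    "\<And>j. slot B j \<Longrightarrow> new1 (rt B, i) = new1 (rt B, j) \<Longrightarrow> i = j"
proof -
  have B: "B \<in> P" using assms by (auto simp: base_def)
  note gr = new1_rt[OF assms(1)]
  show "new1 (rt B, i) \<in> B" "new1 (rt B, i) \<noteq> rt B"
    "\<And>j. slot B j \<Longrightarrow> new1 (rt B, i) = new1 (rt B, j) \<Longrightarrow> i = j"
    using assms(2) rt_lf[OF B] not_is_edgeD[OF B] gr unfolding slot_def by (cases "is_edge B"; auto)+
qed

lemma new1_image: "new1 ` step1_dom V0 edge_roots = V1 - V0"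
proof
  show "new1 ` step1_dom V0 edge_roots \<subseteq> V1 - V0"
  proof
    fix z assume "z \<in> new1 ` step1_dom V0 edge_roots"
    then obtain B i where B: "B \<in> base" "z = new1 (rt B, i)" "slot B i"
      unfolding step1_dom_base by blast
    note p = new1_props[OF B(1,3)]
    have "z \<noteq> rt C" if "C \<in> base" for C
      using p(1,2) B(1,2) that block_eq[of B C z] rt_lf[of C] by (auto simp: base_def)
    then show "z \<in> V1 - V0" using p(1) B by (auto simp: V1_def V0_def)
  qed
  show "V1 - V0 \<subseteq> new1 ` step1_dom V0 edge_roots"
  proof
    fix z assume z: "z \<in> V1 - V0"
    then obtain B where B: "B \<in> base" "z \<in> B" "z \<noteq> rt B" by (auto simp: V1_def V0_def)
    have BP: "B \<in> P" using B by (auto simp: base_def)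
    have "\<exists>i. slot B i \<and> z = new1 (rt B, i)"
    proof (cases "is_edge B")
      case True
      then show ?thesis using is_edgeD(1)[of B z] B new1_rt[OF B(1)] by (auto simp: slot_def)
    next
      case False
      then have "z = lf B \<or> z = ct B \<or> z = ml B" using not_is_edgeD(1)[OF BP, of z] B by blast
      then show ?thesis using False new1_rt[OF B(1)] unfolding slot_def by (metis (full_types))
    qed
    then show "z \<in> new1 ` step1_dom V0 edge_roots" unfolding step1_dom_base using B by blast
  qed
qed

lemma V0_subset_V1: "V0 \<subseteq> V1"
proof
  fix x assume "x \<in> V0"
  then obtain B where "B \<in> base" "B \<in> P" "x = rt B" by (auto simp: V0_def base_def)
  then show "x \<in> V1" using rt_lf[of B] by (auto simp: V1_def)
qed

lemma new1_inj: "inj_on new1 (step1_dom V0 edge_roots)"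
proof (rule inj_onI)
  fix p q assume "p \<in> step1_dom V0 edge_roots" "q \<in> step1_dom V0 edge_roots" and eq: "new1 p = new1 q"
  then obtain B i C j where B: "B \<in> base" "p = (rt B, i)" "slot B i"
    and C: "C \<in> base" "q = (rt C, j)" "slot C j"
    unfolding step1_dom_base by blast
  have "B = C" using new1_props(1)[OF B(1,3)] new1_props(1)[OF C(1,3)] eq B C block_eq[of B C "new1 p"] by (auto simp: base_def)
  moreover from this have "i = j" using B C eq by (intro new1_props(3)[OF B(1,3)]) simp_all
  ultimately show "p = q" using B(2) C(2) by simp
qed

text \<open>Edges between different base blocks join roots and belong to \<open>E0\<close>; the
  others are the edges of a \<open>K\<^sub>2\<close> or a claw.\<close>

lemma edges_E1:
  "E1 = E0 \<union> {{x, new1 (x, 0)} | x. x \<in> edge_roots} \<union> {{x, new1 (x, 1)} | x. x \<in> V0 - edge_roots}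
     \<union> {{new1 (x, 0), new1 (x, 1)} | x. x \<in> V0 - edge_roots} \<union> {{new1 (x, 1), new1 (x, 2)} | x. x \<in> V0 - edge_roots}" (is "_ = ?R")
proof
  show "E1 \<subseteq> ?R"
  proof
    fix e assume "e \<in> E1"
    then have eE: "e \<in> E" "e \<subseteq> V1" by (auto simp: E1_def)
    then obtain u v where uv: "e = {u, v}" "adj u v" using edgeE by blast
    then have e: "e = {u, v}" "adj u v" "u \<in> V1" "v \<in> V1" "e \<in> E" using eE by auto
    then obtain B C where B: "B \<in> base" "u \<in> B" "C \<in> base" "v \<in> C" by (auto simp: V1_def)
    have BP: "B \<in> P" using B by (auto simp: base_def)
    show "e \<in> ?R"
    proof (cases "B = C")
      case False
      then have "u \<in> V0" "v \<in> V0" using base_cross_edge[OF B(1,3) False B(2,4) e(2)] B by (auto simp: V0_def)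
      then show ?thesis using e by (auto simp: E0_def)
    next
      case True
      have x: "rt B \<in> V0" using B by (auto simp: V0_def)
      show ?thesis
      proof (cases "is_edge B")
        case e': True
        have "e = {rt B, lf B}" using is_edgeD(1)[OF e', of u] is_edgeD(1)[OF e', of v] B True e adj_irrefl[of u] by auto
        then have "e = {rt B, new1 (rt B, 0)}" using new1_rt B by simp
        moreover have "rt B \<in> edge_roots" using rt_in_A B e' by blast
        ultimately show ?thesis by blast
      next
        case ne: False
        note c = not_is_edgeD[OF BP ne]
        have "\<not> adj x y" if "x \<in> {rt B, lf B, ml B}" "y \<in> {rt B, lf B, ml B}" for x y
          using that c(2) adj_irrefl adj_sym[of "lf B" "rt B"] adj_sym[of "ml B" "rt B"] adj_sym[of "ml B" "lf B"]
          unfolding claw_def by blast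
        then have "u = ct B \<or> v = ct B" using c(1)[of u] c(1)[of v] B True e(2) by blast
        then have "e = {ct B, rt B} \<or> e = {ct B, lf B} \<or> e = {ct B, ml B}"
          using c(1)[of u] c(1)[of v] B True e adj_irrefl[of u] by auto
        then have "e = {rt B, new1 (rt B, 1)} \<or> e = {new1 (rt B, 0), new1 (rt B, 1)} \<or> e = {new1 (rt B, 1), new1 (rt B, 2)}"
          using new1_rt[OF B(1)] by (auto simp: insert_commute)
        moreover have "rt B \<in> V0 - edge_roots" using rt_in_A B ne x by blast
        ultimately show ?thesis by blast
      qed
    qed
  qed
  have E1I: "{u, v} \<in> E1" if "B \<in> base" "u \<in> B" "v \<in> B" "adj u v" for B u v
    using that edge_iff by (auto simp: E1_def V1_def)
  have edge: "{x, new1 (x, 0)} \<in> E1" if x: "x \<in> edge_roots" for x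
  proof -
    have "x \<in> V0" using x by (auto simp: edge_roots_def)
    then obtain B where B: "B \<in> base" "B \<in> P" "x = rt B" by (rule V0_E)
    then have "is_edge B" using x rt_in_A by blast
    then have "adj (rt B) (lf B)" using is_edgeD by blast
    then show ?thesis using E1I[OF B(1)] rt_lf[OF B(2)] B new1_rt by simp
  qed
  have claw: "{x, new1 (x, 1)} \<in> E1" "{new1 (x, 0), new1 (x, 1)} \<in> E1" "{new1 (x, 1), new1 (x, 2)} \<in> E1"
    if x: "x \<in> V0 - edge_roots" for x
  proof -
    have "x \<in> V0" using x by blast
    then obtain B where B: "B \<in> base" "B \<in> P" "x = rt B" by (rule V0_E)
    then have "\<not> is_edge B" using x rt_in_A by blast
    note c = not_is_edgeD[OF B(2) this]
    have a: "adj (rt B) (ct B)" "adj (lf B) (ct B)" "adj (ct B) (ml B)"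
      using c(2) adj_sym unfolding claw_def by blast+
    have i: "ct B \<in> B" "rt B \<in> B" "lf B \<in> B" "ml B \<in> B" using c(1) by blast+
    show "{x, new1 (x, 1)} \<in> E1" "{new1 (x, 0), new1 (x, 1)} \<in> E1" "{new1 (x, 1), new1 (x, 2)} \<in> E1"
      unfolding B(3) new1_rt[OF B(1)] using E1I[OF B(1)] a i by blast+
  qed
  show "?R \<subseteq> E1"
  proof (intro Un_least)
    show "E0 \<subseteq> E1" using V0_subset_V1 by (auto simp: E0_def E1_def)
  qed (use edge claw in auto)
qed

lemma step1_base: "step1 V0 E0 V1 E1"
  unfolding step1_def
proof (intro exI[of _ edge_roots] exI[of _ new1] conjI)
  show "edge_roots \<subseteq> V0" by (auto simp: edge_roots_def)
  show "inj_on new1 (step1_dom V0 edge_roots)" by (rule new1_inj)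
  show "new1 ` step1_dom V0 edge_roots \<inter> V0 = {}" using new1_image by blast
  show "V1 = V0 \<union> new1 ` step1_dom V0 edge_roots" using new1_image V0_subset_V1 by blast
  show "E1 = E0 \<union> {{x, new1 (x, 0)} | x. x \<in> edge_roots} \<union> {{x, new1 (x, 1)} | x. x \<in> V0 - edge_roots}
     \<union> {{new1 (x, 0), new1 (x, 1)} | x. x \<in> V0 - edge_roots} \<union> {{new1 (x, 1), new1 (x, 2)} | x. x \<in> V0 - edge_roots}"
    by (rule edges_E1)
qed

section \<open>Second step of the construction\<close>

definition out_nb :: "'a \<Rightarrow> 'a set" where
  "out_nb v = {w. adj v w \<and> w \<notin> blk v}"

definition enum :: "'a \<Rightarrow> nat \<Rightarrow> 'a" where
  "enum v = (SOME f. bij_betw f {0..<card (out_nb v)} (out_nb v))"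

text \<open>At \<open>v = lf B\<close> the outside neighbours are the roots of legs, so index 0
  gives the root and index 1 the far end of the leg with number \<open>j\<close>.\<close>

definition new2 :: "'a \<times> nat \<times> nat \<Rightarrow> 'a" where
  "new2 = (\<lambda>(v, j, i). if i = 0 then enum v j else lf (blk (enum v j)))"

lemma enum_bij: "bij_betw (enum v) {0..<card (out_nb v)} (out_nb v)"
proof -
  have "out_nb v \<subseteq> V" using adjV adj_sym by (auto simp: out_nb_def)
  then have "finite (out_nb v)" using finV finite_subset by blast
  then show ?thesis unfolding enum_def using ex_bij_betw_nat_finite someI_ex by metis
qed

lemma blk_lf: "B \<in> base \<Longrightarrow> blk (lf B) = B"
  using blk_eq[of B "lf B"] rt_lf[of B] by (auto simp: base_def)

lemma out_nb_lf:
  assumes "B \<in> base" "w \<in> out_nb (lf B)"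
  shows "leg (blk w)" "rt (blk w) = w" "blk w \<in> P" "is_edge (blk w)" "adj (lf B) w"
    "\<And>v z. v \<in> blk w \<Longrightarrow> z \<notin> blk w \<Longrightarrow> adj v z \<Longrightarrow> v = w \<and> z = lf B"
proof -
  have w: "B \<in> P" "w \<notin> B" "adj (lf B) w" using assms blk_lf[of B] by (auto simp: out_nb_def base_def)
  have "w \<in> V" using w adjV adj_sym by blast
  then have D: "blk w \<in> P" "w \<in> blk w" using blk[of w] by auto
  show "leg (blk w)" "rt (blk w) = w" using leg_of_lf_neighbour[OF w] by auto
  show "is_edge (blk w)" "\<And>v z. v \<in> blk w \<Longrightarrow> z \<notin> blk w \<Longrightarrow> adj v z \<Longrightarrow> v = w \<and> z = lf B"
    using leg_props(2,3)[OF D w] by auto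
  show "blk w \<in> P" "adj (lf B) w" using D w by auto
qed

lemma leg_enum:
  assumes "leg D"
  obtains B j where "B \<in> base" "j < card (out_nb (lf B))" "rt D = enum (lf B) j"
    "blk (rt D) = D" "is_edge D" "\<And>v z. v \<in> D \<Longrightarrow> z \<notin> D \<Longrightarrow> adj v z \<Longrightarrow> v = rt D \<and> z = lf B"
proof -
  obtain B where B: "B \<in> base" "adj (lf B) (rt D)" "rt D \<notin> B" "D \<in> P" "is_edge D"
    "\<And>v z. v \<in> D \<Longrightarrow> z \<notin> D \<Longrightarrow> adj v z \<Longrightarrow> v = rt D \<and> z = lf B"
    using leg_host[OF assms] by metis
  have "rt D \<in> out_nb (lf B)" using B(2,3) blk_lf[OF B(1)] by (simp add: out_nb_def)
  then have "rt D \<in> enum (lf B) ` {0..<card (out_nb (lf B))}"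
    using enum_bij[of "lf B"] by (simp add: bij_betw_def)
  then obtain j where "j < card (out_nb (lf B))" "rt D = enum (lf B) j" by auto
  moreover have "blk (rt D) = D" using blk_eq[OF B(4)] rt_lf[OF B(4)] by blast
  ultimately show thesis using that[of B j] B by blast
qed

text \<open>Every \<open>lf\<close> of a base block is included, also without legs:
  \<open>k = 0\<close> is allowed, and the full set is still a 2-packing.\<close>

abbreviation "L1 \<equiv> lf ` base"
abbreviation "num_legs \<equiv> \<lambda>v. card (out_nb v)"

lemma step2_domE:
  assumes "p \<in> step2_dom L1 num_legs"
  obtains B j i where "B \<in> base" "p = (lf B, j, i)" "j < num_legs (lf B)" "i = 0 \<or> i = 1"
    "enum (lf B) j \<in> out_nb (lf B)"
proof -
  obtain B j i where p: "B \<in> base" "p = (lf B, j, i)" "j < num_legs (lf B)" "i < 2"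
    using assms by (auto simp: step2_dom_def)
  moreover have "i = 0 \<or> i = 1" using p(4) by linarith
  moreover have "enum (lf B) j \<in> out_nb (lf B)"
    using bij_betwE[OF enum_bij[of "lf B"]] p(3) by simp
  ultimately show thesis using that by blast
qed

lemma new2_0: "new2 (v, j, 0) = enum v j" and new2_1: "new2 (v, j, 1) = lf (blk (enum v j))"
  by (simp_all add: new2_def)

lemma new2_in_leg:
  assumes "B \<in> base" "enum (lf B) j \<in> out_nb (lf B)" "i = 0 \<or> i = 1"
  shows "blk (new2 (lf B, j, i)) = blk (enum (lf B) j)"
    "new2 (lf B, j, i) = (if i = 0 then rt (blk (enum (lf B) j)) else lf (blk (enum (lf B) j)))"
proof -
  let ?D = "blk (enum (lf B) j)"
  note w = out_nb_lf[OF assms(1,2)]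
  show new2: "new2 (lf B, j, i) = (if i = 0 then rt ?D else lf ?D)"
    using assms(3) new2_0[of "lf B" j] new2_1[of "lf B" j] w(2) by auto
  show "blk (new2 (lf B, j, i)) = ?D" unfolding new2
    using blk_eq[OF w(3), of "rt ?D"] blk_eq[OF w(3), of "lf ?D"] rt_lf[OF w(3)] by simp
qed

text \<open>The value determines its leg, the only neighbour outside the leg is \<open>lf B\<close>,
  the root of the leg fixes \<open>j\<close>, and \<open>rt\<close> differs from
  \<open>lf\<close>.\<close>

lemma new2_inj: "inj_on new2 (step2_dom L1 num_legs)"
proof (rule inj_onI)
  fix p q assume pq: "p \<in> step2_dom L1 num_legs" "q \<in> step2_dom L1 num_legs" and eq: "new2 p = new2 q"
  from pq(1) obtain B j i where p: "B \<in> base" "p = (lf B, j, i)" "j < num_legs (lf B)" "i = 0 \<or> i = 1"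
    "enum (lf B) j \<in> out_nb (lf B)" by (rule step2_domE)
  from pq(2) obtain C j' i' where q: "C \<in> base" "q = (lf C, j', i')" "j' < num_legs (lf C)" "i' = 0 \<or> i' = 1"
    "enum (lf C) j' \<in> out_nb (lf C)" by (rule step2_domE)
  let ?w = "enum (lf B) j" and ?w' = "enum (lf C) j'"
  note w = out_nb_lf[OF p(1,5)] and w' = out_nb_lf[OF q(1,5)]
  have D: "blk ?w = blk ?w'"
    using new2_in_leg(1)[OF p(1,5,4)] new2_in_leg(1)[OF q(1,5,4)] eq p(2) q(2) by simp
  then have ww: "?w = ?w'" using w(2) w'(2) by metis
  have "lf C \<notin> blk ?w"
  proof
    assume "lf C \<in> blk ?w"
    moreover have "C \<in> P" "\<not> leg C" using q(1) by (auto simp: base_def)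
    ultimately have "C = blk ?w" using block_eq[of C "blk ?w" "lf C"] w(3) rt_lf[of C] by blast
    then show False using w(1) \<open>\<not> leg C\<close> by metis
  qed
  moreover have "?w \<in> blk ?w" using rt_lf[OF w(3)] w(2) by metis
  moreover have "adj ?w (lf C)" using adj_sym[OF w'(5)] ww by metis
  ultimately have lfeq: "lf C = lf B" using w(6)[of ?w "lf C"] by blast
  have jj: "j = j'" using bij_betw_imp_inj_on[OF enum_bij[of "lf B"]] ww p(3) q(3) lfeq
    by (auto dest: inj_onD)
  have "i = i'"
    using new2_in_leg(2)[OF p(1,5,4)] new2_in_leg(2)[OF q(1,5,4)] eq p(2,4) q(2,4) D rt_lf[OF w(3)]
    by (auto split: if_splits)
  with lfeq jj show "p = q" using p(2) q(2) by simp
qed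

lemma new2_image: "new2 ` step2_dom L1 num_legs = V - V1"
proof
  show "new2 ` step2_dom L1 num_legs \<subseteq> V - V1"
  proof
    fix z assume "z \<in> new2 ` step2_dom L1 num_legs"
    then obtain p where z: "z = new2 p" "p \<in> step2_dom L1 num_legs" by blast
    from z(2) obtain B j i where p: "B \<in> base" "p = (lf B, j, i)" "j < num_legs (lf B)" "i = 0 \<or> i = 1"
      "enum (lf B) j \<in> out_nb (lf B)" by (rule step2_domE)
    let ?D = "blk (enum (lf B) j)"
    note w = out_nb_lf[OF p(1,5)]
    have zD: "z \<in> ?D" using new2_in_leg(2)[OF p(1,5,4)] z(1) p(2) rt_lf[OF w(3)] by simp
    have "z \<notin> C" if "C \<in> base" for C
    proof
      assume "z \<in> C"
      moreover have "C \<in> P" "\<not> leg C" using that by (auto simp: base_def)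
      ultimately have "C = ?D" using block_eq[of C ?D z] zD w(3) by blast
      then show False using w(1) \<open>\<not> leg C\<close> by metis
    qed
    then show "z \<in> V - V1" using zD block_subset[OF w(3)] by (auto simp: V1_def)
  qed
  show "V - V1 \<subseteq> new2 ` step2_dom L1 num_legs"
  proof
    fix z assume z: "z \<in> V - V1"
    let ?D = "blk z"
    have D: "?D \<in> P" "z \<in> ?D" using blk[of z] z by auto
    then have "leg ?D" using z by (auto simp: V1_def base_def)
    then obtain B j where B: "B \<in> base" "j < num_legs (lf B)" "rt ?D = enum (lf B) j"
      "blk (rt ?D) = ?D" "is_edge ?D" by (rule leg_enum)
    have "z = rt ?D \<or> z = lf ?D" using is_edgeD(1)[OF B(5), of z] D(2) by blast
    then have "z = new2 (lf B, j, 0) \<or> z = new2 (lf B, j, 1)"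
      using B(3,4) new2_0[of "lf B" j] new2_1[of "lf B" j] by metis
    moreover have i: "(lf B, j, 0) \<in> step2_dom L1 num_legs" "(lf B, j, 1) \<in> step2_dom L1 num_legs"
      using B(1,2) by (auto simp: step2_dom_def)
    ultimately show "z \<in> new2 ` step2_dom L1 num_legs"
      using imageI[OF i(1), of new2] imageI[OF i(2), of new2] by metis
  qed
qed

lemma E1_iff: "{u, v} \<in> E1 \<longleftrightarrow> adj u v \<and> u \<in> V1 \<and> v \<in> V1"
  using edge_iff by (auto simp: E1_def)

lemma V1_subset: "V1 \<subseteq> V"
  using UnP by (auto simp: V1_def base_def)

lemma lf_neighbour:
  assumes B: "B \<in> base" and u: "u \<in> V1" "adj u (lf B)"
  shows "u = (if is_edge B then rt B else ct B)"
proof -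
  have BP: "B \<in> P" using B by (simp add: base_def)
  obtain C where "C \<in> base" "u \<in> C" using u by (auto simp: V1_def)
  then have uB: "u \<in> B" using lf_base_neighbour[OF B _ _ u(2)] by blast
  show ?thesis
  proof (cases "is_edge B")
    case True
    then show ?thesis using is_edgeD(1)[OF True, of u] uB u(2) adj_irrefl[of u] by auto
  next
    case False
    note c = not_is_edgeD[OF BP False]
    have "u \<noteq> rt B" "u \<noteq> ml B" "u \<noteq> lf B"
      using c(2) u(2) adj_sym[OF u(2)] adj_irrefl[of u] unfolding claw_def by auto
    then show ?thesis using c(1)[of u] uB False by auto
  qed
qed

lemma lf_adjacent:
  assumes B: "B \<in> base" shows "(if is_edge B then rt B else ct B) \<in> B" "adj (if is_edge B then rt B else ct B) (lf B)"
proof -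
  have BP: "B \<in> P" using B by (simp add: base_def)
  show "(if is_edge B then rt B else ct B) \<in> B"
    using rt_lf[OF BP] not_is_edgeD(1)[OF BP, of "ct B"] by auto
  show "adj (if is_edge B then rt B else ct B) (lf B)"
    using is_edgeD(2)[of B] not_is_edgeD(2)[OF BP] by (auto simp: claw_def)
qed

lemma leaf_lf: assumes B: "B \<in> base" shows "is_leaf E1 (lf B)"
proof -
  let ?n = "if is_edge B then rt B else ct B"
  have BP: "B \<in> P" using B by (simp add: base_def)
  have V1: "lf B \<in> V1" "?n \<in> V1" using B rt_lf[OF BP] lf_adjacent[OF B] by (auto simp: V1_def)
  have "nbhd E1 (lf B) = {?n}"
  proof
    show "nbhd E1 (lf B) \<subseteq> {?n}" using lf_neighbour[OF B] E1_iff unfolding nbhd_def by blast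
    have "{?n, lf B} \<in> E1" "?n \<noteq> lf B"
      using E1_iff[of ?n "lf B"] V1 lf_adjacent(2)[OF B] adj_irrefl[of "lf B"] by metis+
    then show "{?n} \<subseteq> nbhd E1 (lf B)" by (simp add: nbhd_def del: if_split)
  qed
  then show ?thesis by (simp add: is_leaf_def)
qed

text \<open>In \<open>T\<^sub>1\<close> each \<open>lf B\<close> has its only neighbour in
  \<open>B\<close>. A walk of length at most 2 to \<open>lf C\<close> would give a vertex in two
  blocks.\<close>

lemma packing_lf: "two_packing E1 L1"
  unfolding two_packing_def
proof (intro ballI impI allI notI)
  fix u v k assume uv: "u \<in> L1" "v \<in> L1" "u \<noteq> v" and k: "k \<le> (2::nat)" and r: "(u, v) \<in> adj_rel E1 ^^ k"
  obtain B C where B: "B \<in> base" "u = lf B" and C: "C \<in> base" "v = lf C" using uv by blast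
  have P: "B \<in> P" "C \<in> P" using B C by (auto simp: base_def)
  have nb: "z \<in> D" if "D \<in> base" "adj z (lf D)" "z \<in> V1" for z D
  proof -
    have "z = (if is_edge D then rt D else ct D)" using lf_neighbour that by blast
    then show ?thesis using lf_adjacent(1)[OF that(1)] by simp
  qed
  have "B \<noteq> C" using B C uv by blast
  then have disj: "x \<notin> B \<or> x \<notin> C" for x using block_eq[OF P] by blast
  have "k = 0 \<or> k = 1 \<or> k = 2" using k by linarith
  then show False
  proof (elim disjE)
    assume "k = 0" then show False using r uv by simp
  next
    assume "k = 1"
    then have "{u, v} \<in> E1" using r by (simp add: adj_rel_def)
    then have "adj u v" "u \<in> V1" using E1_iff by blast+
    then have "u \<in> C" using nb C by blast
    then show False using disj[of u] rt_lf[OF P(1)] B by blast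
  next
    assume "k = 2"
    then obtain z where "(u, z) \<in> adj_rel E1" "(z, v) \<in> adj_rel E1" using r by (auto simp: numeral_2_eq_2)
    then have "adj u z" "adj z v" "z \<in> V1" using E1_iff by (auto simp: adj_rel_def)
    then have "z \<in> B" "z \<in> C" using nb[OF B(1), of z] nb[OF C(1), of z] B C adj_sym by blast+
    then show False using disj by blast
  qed
qed

text \<open>An edge that meets a leg lies inside it or joins its root to the \<open>lf\<close> of
  its host. All other edges run within \<open>V1\<close>.\<close>

lemma edges_E:
  "E = E1 \<union> {{v, new2 (v, j, 0)} | v j. v \<in> L1 \<and> j < num_legs v}
     \<union> {{new2 (v, j, 0), new2 (v, j, 1)} | v j. v \<in> L1 \<and> j < num_legs v}" (is "_ = E1 \<union> ?R1 \<union> ?R2")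
proof
  have leg_edge: "{u, v} \<in> ?R1 \<union> ?R2" if "leg D" "u \<in> D" "adj u v" for D u v
  proof -
    from that(1) obtain B j where B: "B \<in> base" "j < num_legs (lf B)" "rt D = enum (lf B) j"
      "blk (rt D) = D" "is_edge D" "\<And>v z. v \<in> D \<Longrightarrow> z \<notin> D \<Longrightarrow> adj v z \<Longrightarrow> v = rt D \<and> z = lf B"
      by (rule leg_enum) blast
    have new2: "new2 (lf B, j, 0) = rt D" "new2 (lf B, j, 1) = lf D"
      using new2_0[of "lf B" j] new2_1[of "lf B" j] B(3,4) by metis+
    have L: "lf B \<in> L1" using B by blast
    show ?thesis
    proof (cases "v \<in> D")
      case True
      then have "{u, v} = {rt D, lf D}"
        using is_edgeD(1)[OF B(5), of u] is_edgeD(1)[OF B(5), of v] that adj_irrefl[of u] by auto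
      then have "{u, v} = {new2 (lf B, j, 0), new2 (lf B, j, 1)}" using new2 by simp
      then have "{u, v} \<in> ?R2" using L B(2) by blast
      then show ?thesis by blast
    next
      case False
      then have "{u, v} = {lf B, new2 (lf B, j, 0)}" using B(6)[OF that(2) False that(3)] new2 by auto
      then have "{u, v} \<in> ?R1" using L B(2) by blast
      then show ?thesis by blast
    qed
  qed
  show "E \<subseteq> E1 \<union> ?R1 \<union> ?R2"
  proof
    fix e assume "e \<in> E"
    then obtain u v where e: "e = {u, v}" "adj u v" using edgeE by blast
    have uv: "u \<in> V" "v \<in> V" using e adjV adj_sym by blast+
    consider "leg (blk u)" | "leg (blk v)" | "blk u \<in> base" "blk v \<in> base"
      using blk[OF uv(1)] blk[OF uv(2)] by (auto simp: base_def)
    then show "e \<in> E1 \<union> ?R1 \<union> ?R2"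
    proof cases
      case 1
      then show ?thesis using leg_edge[OF 1 _ e(2)] blk[OF uv(1)] e(1) by blast
    next
      case 2
      then have "{v, u} \<in> ?R1 \<union> ?R2" using leg_edge[OF 2 _ adj_sym[OF e(2)]] blk[OF uv(2)] by blast
      then show ?thesis using e(1) by (simp add: insert_commute)
    next
      case 3
      then have "u \<in> V1" "v \<in> V1" using blk[OF uv(1)] blk[OF uv(2)] by (auto simp: V1_def)
      then show ?thesis using e E1_iff by blast
    qed
  qed
  have R: "{v, new2 (v, j, 0)} \<in> E \<and> {new2 (v, j, 0), new2 (v, j, 1)} \<in> E" if v: "v \<in> L1" "j < num_legs v" for v j
  proof -
    obtain B where B: "B \<in> base" "v = lf B" using v(1) by blast
    have "enum v j \<in> out_nb v" using bij_betwE[OF enum_bij[of v]] v(2) by simp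
    note w = out_nb_lf[OF B(1) this[unfolded B(2)]]
    show ?thesis using w(2,5) is_edgeD(2)[OF w(4)] edge_iff new2_0[of "lf B" j] new2_1[of "lf B" j] B(2) by metis
  qed
  show "E1 \<union> ?R1 \<union> ?R2 \<subseteq> E"
  proof (intro Un_least)
    show "E1 \<subseteq> E" by (auto simp: E1_def)
    show "?R1 \<subseteq> E" "?R2 \<subseteq> E" using R by blast+
  qed
qed

lemma step2_base: "step2 V1 E1 V E"
  unfolding step2_def
proof (intro exI[of _ L1] exI[of _ num_legs] exI[of _ new2] conjI)
  show "L1 \<subseteq> V1" using rt_lf unfolding V1_def base_def by blast
  show "\<forall>v\<in>L1. is_leaf E1 v" using leaf_lf by blast
  show "two_packing E1 L1" by (rule packing_lf)
  show "inj_on new2 (step2_dom L1 num_legs)" by (rule new2_inj)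
  show "new2 ` step2_dom L1 num_legs \<inter> V1 = {}" using new2_image by blast
  show "V = V1 \<union> new2 ` step2_dom L1 num_legs" using new2_image V1_subset by blast
  show "E = E1 \<union> {{v, new2 (v, j, 0)} | v j. v \<in> L1 \<and> j < num_legs v}
     \<union> {{new2 (v, j, 0), new2 (v, j, 1)} | v j. v \<in> L1 \<and> j < num_legs v}" by (rule edges_E)
qed

lemma in_family: "in_family_T V E"
  unfolding in_family_T_def using tree_V0 step1_base step2_base by blast

end

theorem theorem4p1:
  fixes V :: "'a set" and E :: "'a set set"
  assumes "is_tree V E"
    and "card V \<ge> 4"
    and "2 * gamma_nt V E = card V"
  shows "in_family_T V E"
proof -
  define adj where "adj = (\<lambda>u v. {u, v} \<in> E \<and> u \<noteq> v)"
  have adj_iff: "adj u v \<longleftrightarrow> {u, v} \<in> E \<and> u \<noteq> v" for u v by (simp add: adj_def)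
  have tree: "simple_graph V E" "V \<noteq> {}" "connected_graph V E" "\<not> (\<exists>xs. is_cycle E xs)"
    using assms(1) by (auto simp: is_tree_def)
  have ends: "u \<in> V \<and> v \<in> V" if "adj u v" for u v
  proof -
    have "{u, v} \<in> E" using that adj_iff by blast
    then obtain a b where "{u, v} = {a, b}" "a \<in> V" "b \<in> V"
      using tree(1) unfolding simple_graph_def by metis
    then show ?thesis by (auto simp: doubleton_eq_iff)
  qed
  interpret tree_adj V adj
  proof
    show "finite V" using tree by (auto simp: simple_graph_def)
    show "adj v u" if "adj u v" for u v using that by (auto simp: adj_iff insert_commute)
    show "(x, y) \<notin> {(a, b). adj a b \<and> {a, b} \<noteq> {x, y}}\<^sup>*" if "adj x y" for x y
      using acyclic_edge_is_bridge[OF tree(4), of x y] that unfolding adj_def by blast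
    show "\<not> adj u u" for u by (simp add: adj_iff)
    show "u \<in> V" if "adj u v" for u v using ends[OF that] by blast
  qed
  have E: "E = {{u, v} | u v. adj u v}"
  proof
    show "E \<subseteq> {{u, v} | u v. adj u v}"
    proof
      fix e assume e: "e \<in> E"
      then obtain u v where uv: "e = {u, v}" "u \<noteq> v" using tree(1) unfolding simple_graph_def by metis
      then have "adj u v" using e adj_iff[of u v] by simp
      then show "e \<in> {{u, v} | u v. adj u v}" using uv(1) by blast
    qed
  qed (auto simp: adj_iff)
  have "rel V = {(u, v). adj u v}" using ends unfolding rel_def by blast
  then have "rel V = adj_rel E" by (simp add: adj_rel_def adj_iff)
  then have connV: "conn V" using tree(3) by (simp add: conn_def connected_graph_def)
  have ev: "even (card V)" using assms(3) by (metis dvd_triv_left)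
  obtain P where P: "\<Union>P = V" "pairwise disjnt P" "\<forall>B\<in>P. odd_block B"
    using odd_partition[OF finV connV ev tree(2)] by blast
  have finP: "finite P" using P(1) finV finite_UnionD by metis
  have finB: "finite B" if "B \<in> P" for B using that P(1) finV by (meson Union_upper finite_subset)
  have cases: "edge_block B \<or> claw_block B \<or> (\<exists>S M. cert B S M \<and> 2 * card S + 2 \<le> card B)" if "B \<in> P" for B
    using odd_block_cases that P(3) finB by blast
  have tiles: "\<forall>B\<in>P. tile B"
  proof
    fix B assume B: "B \<in> P"
    have "tile B" if "cert B S M" "2 * card S + 2 \<le> card B" for S M
      unfolding tile_def using that finB[OF B] by (meson add_leD1)
    then show "tile B" using cases[OF B] edge_block_tile claw_block_tile by blast
  qed
  \<comment> \<open>A smaller certificate would extend to an NTD-set of \<open>V\<close> with fewer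
    than \<open>card V div 2\<close> vertices.\<close>
  have tight: "card (\<Union>Q) \<le> 2 * card S" if Q: "Q \<subseteq> P" "\<Union>Q \<noteq> {}" "cert (\<Union>Q) S M" for Q S M
  proof -
    obtain S' M' where S': "cert V S' M'" "2 * card S' + card (\<Union>Q) \<le> 2 * card S + card V"
      using cert_extend[OF finP P(2) tiles, unfolded P(1), OF connV Q] by blast
    have "ntd_set V E S'" using cert_ntd_set[OF adj_iff S'(1)] .
    then have "gamma_nt V E \<le> card S'" unfolding gamma_nt_def by (intro Least_le) blast
    then show ?thesis using S'(2) assms(3) by linarith
  qed
  \<comment> \<open>A block of the third kind violates tightness for \<open>Q = {B}\<close>.\<close>
  have blocks: "edge_block B \<or> claw_block B" if B: "B \<in> P" for B
  proof (rule ccontr)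
    assume "\<not> ?thesis"
    then obtain S M where S: "cert B S M" "2 * card S + 2 \<le> card B" using cases[OF B] by blast
    have "B \<noteq> {}" using P(3) B by (auto simp: odd_block_def)
    then have "card B \<le> 2 * card S" using tight[of "{B}" S M] B S(1) by simp
    then show False using S(2) by simp
  qed
  interpret tiled_tree V adj P
    using connV P blocks tight by unfold_locales (auto simp: odd_block_def)
  have "\<forall>B\<in>P. \<exists>x c l m. rooted_edge B x l \<or> rooted_claw B x c l m"
    using rooted_block by blast
  then obtain rt ct lf ml where
    rooted: "\<forall>B\<in>P. rooted_edge B (rt B) (lf B) \<or> rooted_claw B (rt B) (ct B) (lf B) (ml B)"
    by metis
  interpret rooted_tiling V adj P E rt lf ct ml
    using E tree rooted by unfold_locales blast+
  show ?thesis by (rule in_family)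
qed

end
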